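(* Let $A_1$, $A_2$ be Hausdorff $LC^*$-algebras. Then there exists exactly one $LC^*$-topology $\tau\ge\varepsilon$ on $A_1\otimes A_2$ for which the canonical bilinear map $\otimes\colon A_1\times A_2\to A_1\otimes A_2$ is continuous, namely the injective topology $\varepsilon$.
   Context: "Algebra" means commutative associative algebra over $\mathbb{C}$ with unit. An involutive algebra is an algebra with a conjugate-linear map $x\mapsto x^*$ satisfying $(x^* )^*=x$, $(xy)^*=y^*x^*$. A $C^*$-seminorm is a seminorm $p$ with $p(xx^* )=p(x)^2$ for all $x$. An $LC^*$-topology is a topology on an involutive algebra defined by a family of $C^*$-seminorms; an $LC^*$-algebra is an involutive algebra with an $LC^*$-topology. The algebraic tensor product $A_1\otimes A_2$ is an involutive algebra with $(x_1\otimes x_2)(y_1\otimes y_2)=x_1y_1\otimes x_2y_2$ and $(x_1\otimes x_2)^*=x_1^*\otimes x_2^*$. The injective topology $\varepsilon$ on $A_1\otimes A_2$ is generated by the seminorms $$(p_1\otimes_{\varepsilon}p_2)\Bigl(\sum_j a_{1j}\otimes a_{2j}\Bigr)=\sup\Bigl\{\Bigl|\sum_j w_1(a_{1j})w_2(a_{2j})\Bigr| : w_i \text{ a linear functional on } A_i,\ |w_i|\le p_i,\ i=1,2\Bigr\},$$ where $p_i$ ranges over all continuous $C^*$-seminorms on $A_i$. Here $\tau\ge\varepsilon$ means that $\tau$ is finer than or equal to $\varepsilon$. *)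

theory Defs
  imports "HOL-Analysis.Analysis" "HOL-Library.Poly_Mapping"
begin

section \<open>Involutive algebras\<close>

text \<open>
  Algebras are commutative, associative and unital over the complex numbers. The class
  \<^class>\<open>comm_ring_1\<close> is avoided because it imposes \<open>0 \<noteq> 1\<close>; here the zero algebra is allowed.
\<close>

class scaleC =
  fixes scaleC :: "complex \<Rightarrow> 'a \<Rightarrow> 'a"  (infixr \<open>*\<^sub>C\<close> 75)

class complex_comm_algebra = comm_ring + comm_monoid_mult + scaleC +
  assumes scaleC_add_right: "c *\<^sub>C (x + y) = c *\<^sub>C x + c *\<^sub>C y"
    and scaleC_add_left: "(c + d) *\<^sub>C x = c *\<^sub>C x + d *\<^sub>C x"
    and scaleC_scaleC: "c *\<^sub>C (d *\<^sub>C x) = (c * d) *\<^sub>C x"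
    and scaleC_one: "1 *\<^sub>C x = x"
    and mult_scaleC_left: "(c *\<^sub>C x) * y = c *\<^sub>C (x * y)"

class involution =
  fixes star :: "'a \<Rightarrow> 'a"

class involutive_algebra = complex_comm_algebra + involution +
  assumes star_add: "star (x + y) = star x + star y"
    and star_scaleC: "star (c *\<^sub>C x) = cnj c *\<^sub>C star x"
    and star_star: "star (star x) = x"
    and star_mult: "star (x * y) = star y * star x"

lemma vector_space_scaleC:
  "vector_space (scaleC :: complex \<Rightarrow> 'a \<Rightarrow> 'a::complex_comm_algebra)"
  by unfold_locales (simp_all add: scaleC_add_right scaleC_add_left scaleC_scaleC scaleC_one)

lemma mult_scaleC_right:
  fixes x y :: "'a::complex_comm_algebra"
  shows "x * (c *\<^sub>C y) = c *\<^sub>C (x * y)"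
  by (metis mult.commute mult_scaleC_left)

abbreviation clinear_functional :: "('a::complex_comm_algebra \<Rightarrow> complex) \<Rightarrow> bool" where
  "clinear_functional w \<equiv> Vector_Spaces.linear scaleC (*) w"

lemma clinear_functional_iff:
  "clinear_functional w \<longleftrightarrow>
    (\<forall>x y. w (x + y) = w x + w y) \<and> (\<forall>c x. w (c *\<^sub>C x) = c * w x)"
proof -
  have "vector_space ((*) :: complex \<Rightarrow> complex \<Rightarrow> complex)"
    by unfold_locales (simp_all add: algebra_simps)
  then show ?thesis
    by (auto simp: Vector_Spaces.linear_def module_hom_def module_hom_axioms_def
        vector_space_scaleC module_iff_vector_space)
qed

section \<open>\<open>LC\<^sup>*\<close>-topologies\<close>

definition cseminorm :: "('a::complex_comm_algebra \<Rightarrow> real) \<Rightarrow> bool" where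
  "cseminorm p \<longleftrightarrow>
    (\<forall>x. 0 \<le> p x) \<and> (\<forall>x y. p (x + y) \<le> p x + p y) \<and> (\<forall>c x. p (c *\<^sub>C x) = cmod c * p x)"

definition cstar_seminorm :: "('a::involutive_algebra \<Rightarrow> real) \<Rightarrow> bool" where
  "cstar_seminorm p \<longleftrightarrow> cseminorm p \<and> (\<forall>x. p (x * star x) = (p x)\<^sup>2)"

text \<open>
  \<^term>\<open>UNIV\<close> is inserted so that the empty family yields the indiscrete topology on the whole type.
\<close>

definition seminorm_topology :: "('a::complex_comm_algebra \<Rightarrow> real) set \<Rightarrow> 'a topology" where
  "seminorm_topology P =
    topology_generated_by (insert UNIV {{y. p (y - x) < e} | p x e. p \<in> P \<and> e > 0})"

definition lc_star_topology :: "'a::involutive_algebra topology \<Rightarrow> bool" where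
  "lc_star_topology T \<longleftrightarrow> (\<exists>P. (\<forall>p\<in>P. cstar_seminorm p) \<and> T = seminorm_topology P)"

definition finer_topology :: "'a topology \<Rightarrow> 'a topology \<Rightarrow> bool" where
  "finer_topology S T \<longleftrightarrow> (\<forall>U. openin T U \<longrightarrow> openin S U)"

section \<open>The algebraic tensor product\<close>

text \<open>
  The tensor product is the free complex vector space on pairs of elements, modulo the subspace
  spanned by the bilinearity relations. Multiplication of free generators is componentwise, so
  the free vector space is the monoid algebra of the multiplicative monoid of pairs. Since
  the convolution product on \<^type>\<open>poly_mapping\<close> is taken with respect to an additive monoid of
  keys, that multiplicative monoid is written additively on the type \<open>gen\<close> of free generators.
\<close>

datatype ('a, 'b) gen = Gen 'a 'b

instantiation gen :: (comm_monoid_mult, comm_monoid_mult) comm_monoid_add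
begin

definition zero_gen :: "('a, 'b) gen" where
  "zero_gen = Gen 1 1"

fun plus_gen :: "('a, 'b) gen \<Rightarrow> ('a, 'b) gen \<Rightarrow> ('a, 'b) gen" where
  "plus_gen (Gen a b) (Gen a' b') = Gen (a * a') (b * b')"

instance
proof
  fix x y z :: "('a, 'b) gen"
  show "x + y + z = x + (y + z)" by (cases x; cases y; cases z) (simp add: mult.assoc)
  show "x + y = y + x" by (cases x; cases y) (simp add: mult.commute)
  show "0 + x = x" by (cases x) (simp add: zero_gen_def)
qed

end

fun star_gen :: "('a::involutive_algebra, 'b::involutive_algebra) gen \<Rightarrow> ('a, 'b) gen" where
  "star_gen (Gen a b) = Gen (star a) (star b)"

lemma star_gen_star_gen [simp]: "star_gen (star_gen k) = k"
  by (cases k) (simp add: star_star)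

lemma star_gen_eq_iff: "star_gen k = l \<longleftrightarrow> k = star_gen l"
  by auto

lemma star_gen_add: "star_gen (k + l) = star_gen k + star_gen l"
  by (cases k; cases l) (simp add: star_mult mult.commute)

type_synonym ('a, 'b) free = "('a, 'b) gen \<Rightarrow>\<^sub>0 complex"

abbreviation free_scale ::
    "complex \<Rightarrow> ('a::comm_monoid_mult, 'b::comm_monoid_mult) free \<Rightarrow> ('a, 'b) free" where
  "free_scale c x \<equiv> Poly_Mapping.single 0 c * x"

abbreviation pure :: "'a \<Rightarrow> 'b \<Rightarrow> ('a, 'b) free" where
  "pure a b \<equiv> Poly_Mapping.single (Gen a b) 1"

interpretation free: vector_space free_scale
  by unfold_locales
    (simp_all add: distrib_left distrib_right single_add mult_single flip: mult.assoc)

lemma free_induct [case_names single add]: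
  fixes x :: "'k \<Rightarrow>\<^sub>0 complex"
  assumes single: "\<And>k c. P (Poly_Mapping.single k c)"
    and add: "\<And>x y. P x \<Longrightarrow> P y \<Longrightarrow> P (x + y)"
  shows "P x"
proof (induction x rule: update_induct)
  case const
  show ?case using single[of undefined 0] by simp
next
  case (update f a b)
  have "Poly_Mapping.update a b f = Poly_Mapping.single a b + f"
    using update(1)
    by (intro poly_mapping_eqI)
      (auto simp: lookup_update lookup_add lookup_single when_def in_keys_iff)
  then show ?case using add[OF single update(3)] by simp
qed

definition tensor_relations ::
    "('a::complex_comm_algebra, 'b::complex_comm_algebra) free set" where
  "tensor_relations =
    {pure (a + a') b - (pure a b + pure a' b) | a a' b. True} \<union>
    {pure a (b + b') - (pure a b + pure a b') | a b b'. True} \<union>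
    {pure (c *\<^sub>C a) b - free_scale c (pure a b) | c a b. True} \<union>
    {pure a (c *\<^sub>C b) - free_scale c (pure a b) | c a b. True}"

definition tensor_eq ::
    "('a::complex_comm_algebra, 'b::complex_comm_algebra) free \<Rightarrow> ('a, 'b) free \<Rightarrow> bool" where
  "tensor_eq x y \<longleftrightarrow> x - y \<in> free.span tensor_relations"

lemma equivp_tensor_eq:
  "equivp (tensor_eq :: ('a::complex_comm_algebra, 'b::complex_comm_algebra) free \<Rightarrow> _)"
proof (rule equivpI)
  let ?R = "tensor_eq :: ('a, 'b) free \<Rightarrow> _"
  show "reflp ?R" by (simp add: reflp_def tensor_eq_def free.span_zero)
  show "symp ?R"
    by (metis sympI tensor_eq_def free.span_neg minus_diff_eq)
  show "transp ?R"
  proof (rule transpI)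
    fix x y z :: "('a, 'b) free"
    assume "tensor_eq x y" "tensor_eq y z"
    then have "(x - y) + (y - z) \<in> free.span tensor_relations"
      unfolding tensor_eq_def by (rule free.span_add)
    then show "tensor_eq x z" by (simp add: tensor_eq_def)
  qed
qed

lemma tensor_relations_single_mult:
  assumes "r \<in> tensor_relations"
  shows "Poly_Mapping.single k d * r \<in> free.span tensor_relations"
proof -
  obtain u v where k: "k = Gen u v" by (cases k)
  have "Poly_Mapping.single k 1 * r \<in> tensor_relations"
    using assms[unfolded tensor_relations_def]
  proof (elim UnE CollectE exE conjE)
    fix a a' b assume "r = pure (a + a') b - (pure a b + pure a' b)"
    then have "Poly_Mapping.single k 1 * r =
        pure (u * a + u * a') (v * b) - (pure (u * a) (v * b) + pure (u * a') (v * b))"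
      by (simp add: k right_diff_distrib distrib_left mult_single)
    then show ?thesis unfolding tensor_relations_def by blast
  next
    fix a b b' assume "r = pure a (b + b') - (pure a b + pure a b')"
    then have "Poly_Mapping.single k 1 * r =
        pure (u * a) (v * b + v * b') - (pure (u * a) (v * b) + pure (u * a) (v * b'))"
      by (simp add: k right_diff_distrib distrib_left mult_single)
    then show ?thesis unfolding tensor_relations_def by blast
  next
    fix c a b assume "r = pure (c *\<^sub>C a) b - free_scale c (pure a b)"
    then have "Poly_Mapping.single k 1 * r =
        pure (c *\<^sub>C (u * a)) (v * b) - free_scale c (pure (u * a) (v * b))"
      by (simp add: k right_diff_distrib mult_single mult_scaleC_right)
    then show ?thesis unfolding tensor_relations_def by blast
  next
    fix c a b assume "r = pure a (c *\<^sub>C b) - free_scale c (pure a b)"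
    then have "Poly_Mapping.single k 1 * r =
        pure (u * a) (c *\<^sub>C (v * b)) - free_scale c (pure (u * a) (v * b))"
      by (simp add: k right_diff_distrib mult_single mult_scaleC_right)
    then show ?thesis unfolding tensor_relations_def by blast
  qed
  then have "free_scale d (Poly_Mapping.single k 1 * r) \<in> free.span tensor_relations"
    by (intro free.span_scale free.span_base)
  then show ?thesis by (simp add: mult_single flip: mult.assoc)
qed

lemma span_tensor_relations_mult:
  assumes "r \<in> free.span tensor_relations"
  shows "x * r \<in> free.span tensor_relations"
proof (induction x rule: free_induct)
  case (single k c)
  show ?case using assms
  proof (induction rule: free.span_induct_alt)
    case base
    show ?case by (simp add: free.span_zero)
  next
    case (step d r s)
    have "free_scale d (Poly_Mapping.single k c * r) + Poly_Mapping.single k c * s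
        \<in> free.span tensor_relations"
      by (rule free.span_add[OF free.span_scale[OF tensor_relations_single_mult[OF step(1)]] step(2)])
    then show ?case by (simp add: distrib_left mult.left_commute)
  qed
next
  case (add x y)
  then show ?case by (simp add: distrib_right free.span_add)
qed

lift_definition free_star ::
    "('a::involutive_algebra, 'b::involutive_algebra) free \<Rightarrow> ('a, 'b) free"
  is "\<lambda>x k. cnj (x (star_gen k))"
proof -
  fix x :: "('a, 'b) gen \<Rightarrow> complex"
  assume "finite {k. x k \<noteq> 0}"
  moreover have "inj star_gen" by (metis injI star_gen_star_gen)
  ultimately have "finite (star_gen -` {k. x k \<noteq> 0})" by (rule finite_vimageI)
  then show "finite {k. cnj (x (star_gen k)) \<noteq> 0}" by (simp add: vimage_def)
qed

lemma free_star_zero: "free_star 0 = 0"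
  by transfer auto

lemma free_star_add: "free_star (x + y) = free_star x + free_star y"
  by transfer auto

lemma free_star_diff: "free_star (x - y) = free_star x - free_star y"
  by transfer auto

lemma free_star_star: "free_star (free_star x) = x"
  by transfer auto

lemma free_star_single:
  "free_star (Poly_Mapping.single k c) = Poly_Mapping.single (star_gen k) (cnj c)"
  by transfer (auto simp: when_def star_gen_eq_iff)

lemma free_star_single_mult:
  "free_star (Poly_Mapping.single k c * y) = free_star (Poly_Mapping.single k c) * free_star y"
  by (induction y rule: free_induct)
    (simp_all add: free_star_single mult_single star_gen_add distrib_left free_star_add)

lemma free_star_mult: "free_star (x * y) = free_star x * free_star y"
  by (induction x rule: free_induct)
    (simp_all add: free_star_single_mult distrib_right free_star_add)

lemma star_gen_zero: "star_gen 0 = 0"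
  by (metis add_0 add.commute star_gen_add star_gen_star_gen)

lemma free_star_scale: "free_star (free_scale c x) = free_scale (cnj c) (free_star x)"
  by (simp add: free_star_mult free_star_single star_gen_zero)

lemma free_star_relation:
  assumes "r \<in> tensor_relations"
  shows "free_star r \<in> tensor_relations"
  using assms unfolding tensor_relations_def
  apply (elim UnE CollectE exE conjE)
     apply (simp_all only: free_star_diff free_star_add free_star_scale free_star_single
      star_gen.simps star_add star_scaleC complex_cnj_one)
     apply blast+
  done

lemma free_star_span:
  assumes "r \<in> free.span tensor_relations"
  shows "free_star r \<in> free.span tensor_relations"
  using assms
proof (induction rule: free.span_induct_alt)
  case base
  show ?case by (simp add: free_star_zero free.span_zero)
next
  case (step d r s)
  have "free_scale (cnj d) (free_star r) + free_star s \<in> free.span tensor_relations"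
    by (rule free.span_add[OF free.span_scale[OF free.span_base[OF
            free_star_relation[OF step(1)]]] step(2)])
  then show ?case by (simp only: free_star_add free_star_scale)
qed

quotient_type (overloaded) ('a, 'b) tensor =
  "('a::complex_comm_algebra, 'b::complex_comm_algebra) free" / tensor_eq
  by (rule equivp_tensor_eq)

instantiation tensor :: (complex_comm_algebra, complex_comm_algebra) complex_comm_algebra
begin

lift_definition zero_tensor :: "('a, 'b) tensor" is 0 .

lift_definition one_tensor :: "('a, 'b) tensor" is 1 .

lift_definition plus_tensor :: "('a, 'b) tensor \<Rightarrow> ('a, 'b) tensor \<Rightarrow> ('a, 'b) tensor" is "(+)"
  unfolding tensor_eq_def by (simp add: add_diff_add free.span_add)

lift_definition uminus_tensor :: "('a, 'b) tensor \<Rightarrow> ('a, 'b) tensor" is uminus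
  unfolding tensor_eq_def by (drule free.span_neg) simp

lift_definition minus_tensor :: "('a, 'b) tensor \<Rightarrow> ('a, 'b) tensor \<Rightarrow> ('a, 'b) tensor" is "(-)"
proof -
  fix x x' y y' :: "('a, 'b) free"
  assume "tensor_eq x x'" "tensor_eq y y'"
  then have "(x - x') - (y - y') \<in> free.span tensor_relations"
    unfolding tensor_eq_def by (rule free.span_diff)
  then show "tensor_eq (x - y) (x' - y')"
    by (simp add: tensor_eq_def algebra_simps)
qed

lift_definition times_tensor :: "('a, 'b) tensor \<Rightarrow> ('a, 'b) tensor \<Rightarrow> ('a, 'b) tensor" is "(*)"
proof -
  fix x x' y y' :: "('a, 'b) free"
  assume "tensor_eq x x'" "tensor_eq y y'"
  then have "y * (x - x') + x' * (y - y') \<in> free.span tensor_relations"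
    unfolding tensor_eq_def by (intro free.span_add span_tensor_relations_mult)
  then show "tensor_eq (x * y) (x' * y')"
    by (simp add: tensor_eq_def algebra_simps)
qed

lift_definition scaleC_tensor :: "complex \<Rightarrow> ('a, 'b) tensor \<Rightarrow> ('a, 'b) tensor" is free_scale
  unfolding tensor_eq_def by (simp add: free.span_scale flip: right_diff_distrib)

instance
proof
  fix x y z :: "('a, 'b) tensor" and c d :: complex
  have *: "tensor_eq u v" if "u = v" for u v :: "('a, 'b) free"
    using that by (simp add: tensor_eq_def free.span_zero)
  show "x + y + z = x + (y + z)" by transfer (rule *, simp add: algebra_simps)
  show "x + y = y + x" by transfer (rule *, simp add: algebra_simps)
  show "0 + x = x" by transfer (rule *, simp)
  show "- x + x = 0" by transfer (rule *, simp)
  show "x - y = x + - y" by transfer (rule *, simp)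
  show "x * y * z = x * (y * z)" by transfer (rule *, simp add: mult.assoc)
  show "x * y = y * x" by transfer (rule *, simp add: mult.commute)
  show "1 * x = x" by transfer (rule *, simp)
  show "(x + y) * z = x * z + y * z" by transfer (rule *, simp add: distrib_right)
  show "c *\<^sub>C (x + y) = c *\<^sub>C x + c *\<^sub>C y" by transfer (rule *, simp add: distrib_left)
  show "(c + d) *\<^sub>C x = c *\<^sub>C x + d *\<^sub>C x"
    by transfer (rule *, simp add: single_add distrib_right)
  show "c *\<^sub>C (d *\<^sub>C x) = (c * d) *\<^sub>C x"
    by transfer (rule *, simp add: mult_single flip: mult.assoc)
  show "1 *\<^sub>C x = x" by transfer (rule *, simp)
  show "(c *\<^sub>C x) * y = c *\<^sub>C (x * y)" by transfer (rule *, simp add: mult.assoc)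
qed

end

instantiation tensor :: (involutive_algebra, involutive_algebra) involutive_algebra
begin

lift_definition star_tensor :: "('a, 'b) tensor \<Rightarrow> ('a, 'b) tensor" is free_star
  unfolding tensor_eq_def by (metis free_star_diff free_star_span)

instance
proof
  fix x y :: "('a, 'b) tensor" and c :: complex
  have *: "tensor_eq u v" if "u = v" for u v :: "('a, 'b) free"
    using that by (simp add: tensor_eq_def free.span_zero)
  show "star (x + y) = star x + star y" by transfer (rule *, simp add: free_star_add)
  show "star (c *\<^sub>C x) = cnj c *\<^sub>C star x" by transfer (rule *, simp add: free_star_scale)
  show "star (star x) = x" by transfer (rule *, simp add: free_star_star)
  show "star (x * y) = star y * star x"
    by transfer (rule *, simp add: free_star_mult mult.commute)
qed

end

lift_definition tensor ::
    "'a::complex_comm_algebra \<Rightarrow> 'b::complex_comm_algebra \<Rightarrow> ('a, 'b) tensor"  (infixr \<open>\<otimes>\<^sub>t\<close> 72)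
  is pure .

lemma tensor_add_left: "(a + a') \<otimes>\<^sub>t b = a \<otimes>\<^sub>t b + a' \<otimes>\<^sub>t b"
  by transfer (unfold tensor_eq_def tensor_relations_def, rule free.span_base, blast)

lemma tensor_add_right: "a \<otimes>\<^sub>t (b + b') = a \<otimes>\<^sub>t b + a \<otimes>\<^sub>t b'"
  by transfer (unfold tensor_eq_def tensor_relations_def, rule free.span_base, blast)

lemma tensor_scaleC_left: "(c *\<^sub>C a) \<otimes>\<^sub>t b = c *\<^sub>C (a \<otimes>\<^sub>t b)"
  by transfer (unfold tensor_eq_def tensor_relations_def, rule free.span_base, blast)

lemma tensor_scaleC_right: "a \<otimes>\<^sub>t (c *\<^sub>C b) = c *\<^sub>C (a \<otimes>\<^sub>t b)"
  by transfer (unfold tensor_eq_def tensor_relations_def, rule free.span_base, blast)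

lemma tensor_mult: "(a \<otimes>\<^sub>t b) * (a' \<otimes>\<^sub>t b') = (a * a') \<otimes>\<^sub>t (b * b')"
  by transfer (simp add: mult_single tensor_eq_def free.span_zero)

lemma tensor_one: "1 \<otimes>\<^sub>t 1 = 1"
  by transfer (simp add: tensor_eq_def free.span_zero flip: zero_gen_def)

lemma tensor_star: "star (a \<otimes>\<^sub>t b) = star a \<otimes>\<^sub>t star b"
  by transfer (simp add: free_star_single tensor_eq_def free.span_zero)

lemma tensor_induct [case_names tensor add]:
  fixes z :: "('a::complex_comm_algebra, 'b::complex_comm_algebra) tensor"
  assumes tensor: "\<And>a b. P (a \<otimes>\<^sub>t b)"
    and add: "\<And>x y. P x \<Longrightarrow> P y \<Longrightarrow> P (x + y)"
  shows "P z"
proof -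
  have "P (abs_tensor x)" for x :: "('a, 'b) free"
  proof (induction x rule: free_induct)
    case (single k c)
    obtain a b where k: "k = Gen a b" by (cases k)
    have "abs_tensor (Poly_Mapping.single k c) = c *\<^sub>C (a \<otimes>\<^sub>t b)"
      by (simp add: k scaleC_tensor.abs_eq tensor.abs_eq mult_single)
    also have "\<dots> = (c *\<^sub>C a) \<otimes>\<^sub>t b" by (simp add: tensor_scaleC_left)
    finally show ?case using tensor by simp
  next
    case (add x y)
    then show ?case using assms(2)[OF add] by (simp add: plus_tensor.abs_eq)
  qed
  then show ?thesis by (metis Quotient_abs_rep[OF Quotient_tensor])
qed

definition bilinear_form ::
    "('a::complex_comm_algebra \<Rightarrow> 'b::complex_comm_algebra \<Rightarrow> complex) \<Rightarrow> bool" where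
  "bilinear_form B \<longleftrightarrow>
    (\<forall>a. clinear_functional (B a)) \<and> (\<forall>b. clinear_functional (\<lambda>a. B a b))"

fun gen_form :: "('a \<Rightarrow> 'b \<Rightarrow> complex) \<Rightarrow> ('a, 'b) gen \<Rightarrow> complex" where
  "gen_form B (Gen a b) = B a b"

definition free_form :: "('a \<Rightarrow> 'b \<Rightarrow> complex) \<Rightarrow> ('a, 'b) free \<Rightarrow> complex" where
  "free_form B x = (\<Sum>k\<in>Poly_Mapping.keys x. Poly_Mapping.lookup x k * gen_form B k)"

lemma free_form_single: "free_form B (Poly_Mapping.single k c) = c * gen_form B k"
  by (cases "c = 0") (simp_all add: free_form_def)

lemma free_form_add: "free_form B (x + y) = free_form B x + free_form B y"
  unfolding free_form_def
  by (rule setsum_keys_plus_distrib) (simp_all add: distrib_right)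

lemma free_form_diff: "free_form B (x - y) = free_form B x - free_form B y"
  by (metis add_diff_cancel diff_add_cancel free_form_add)

lemma free_form_scale: "free_form B (free_scale c x) = c * free_form B x"
  by (induction x rule: free_induct)
    (simp_all add: mult_single free_form_single distrib_left free_form_add)

lemma free_form_span:
  assumes "bilinear_form B" and "r \<in> free.span tensor_relations"
  shows "free_form B r = 0"
  using assms(2)
proof (induction rule: free.span_induct_alt)
  case base
  show ?case by (simp add: free_form_def)
next
  case (step c r s)
  have "free_form B r = 0"
    using step(1) assms(1) unfolding tensor_relations_def bilinear_form_def clinear_functional_iff
    by (elim UnE CollectE exE conjE)
      (simp_all only: free_form_diff free_form_add free_form_scale free_form_single
        gen_form.simps, simp_all)
  with step show ?case by (simp add: free_form_add free_form_scale)
qed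

text \<open>
  The linear form on the tensor product induced by a bilinear form, with junk value 0 when the
  argument is not bilinear.
\<close>

lift_definition tensor_form ::
    "('a::complex_comm_algebra \<Rightarrow> 'b::complex_comm_algebra \<Rightarrow> complex) \<Rightarrow> ('a, 'b) tensor \<Rightarrow> complex"
  is "\<lambda>B x. if bilinear_form B then free_form B x else 0"
proof -
  fix B :: "'a \<Rightarrow> 'b \<Rightarrow> complex" and x y :: "('a, 'b) free"
  assume "tensor_eq x y"
  then have "bilinear_form B \<Longrightarrow> free_form B (x - y) = 0"
    unfolding tensor_eq_def by (simp add: free_form_span)
  then show "(if bilinear_form B then free_form B x else 0) =
      (if bilinear_form B then free_form B y else 0)"
    by (simp add: free_form_diff)
qed

lemma tensor_form_tensor: "bilinear_form B \<Longrightarrow> tensor_form B (a \<otimes>\<^sub>t b) = B a b"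
  by transfer (simp add: free_form_single)

lemma tensor_form_add: "tensor_form B (x + y) = tensor_form B x + tensor_form B y"
  by transfer (simp add: free_form_add)

lemma tensor_form_scaleC: "tensor_form B (c *\<^sub>C x) = c * tensor_form B x"
  by transfer (simp add: free_form_scale)

lemma tensor_form_sum:
  assumes "bilinear_form B"
  shows "tensor_form B (\<Sum>j\<in>J. a j \<otimes>\<^sub>t b j) = (\<Sum>j\<in>J. B (a j) (b j))"
proof -
  have 0: "tensor_form B 0 = 0"
    using tensor_form_add[of B 0 0] by simp
  show ?thesis
    by (induction J rule: infinite_finite_induct)
      (simp_all add: 0 tensor_form_add tensor_form_tensor[OF assms])
qed

section \<open>The injective topology\<close>

definition injective_seminorm ::
    "('a::complex_comm_algebra \<Rightarrow> real) \<Rightarrow> ('b::complex_comm_algebra \<Rightarrow> real) \<Rightarrow>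
      ('a, 'b) tensor \<Rightarrow> real"  (infixr \<open>\<otimes>\<^sub>\<epsilon>\<close> 72) where
  "(p1 \<otimes>\<^sub>\<epsilon> p2) z =
    Sup {cmod (tensor_form (\<lambda>a b. w1 a * w2 b) z) | w1 w2.
      clinear_functional w1 \<and> (\<forall>a. cmod (w1 a) \<le> p1 a) \<and>
      clinear_functional w2 \<and> (\<forall>b. cmod (w2 b) \<le> p2 b)}"

lemma bilinear_form_mult:
  "clinear_functional w1 \<Longrightarrow> clinear_functional w2 \<Longrightarrow> bilinear_form (\<lambda>a b. w1 a * w2 b)"
  by (simp add: bilinear_form_def clinear_functional_iff algebra_simps)

lemma injective_seminorm_sum:
  "(p1 \<otimes>\<^sub>\<epsilon> p2) (\<Sum>j\<in>J. a j \<otimes>\<^sub>t b j) =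
    Sup {cmod (\<Sum>j\<in>J. w1 (a j) * w2 (b j)) | w1 w2.
      clinear_functional w1 \<and> (\<forall>a. cmod (w1 a) \<le> p1 a) \<and>
      clinear_functional w2 \<and> (\<forall>b. cmod (w2 b) \<le> p2 b)}"
  unfolding injective_seminorm_def
  by (intro arg_cong[where f = Sup] Collect_cong ex_cong1)
    (auto simp: tensor_form_sum bilinear_form_mult)

definition injective_topology ::
    "'a::involutive_algebra topology \<Rightarrow> 'b::involutive_algebra topology \<Rightarrow>
      ('a, 'b) tensor topology" where
  "injective_topology T1 T2 =
    seminorm_topology {p1 \<otimes>\<^sub>\<epsilon> p2 | p1 p2.
      cstar_seminorm p1 \<and> continuous_map T1 euclideanreal p1 \<and>
      cstar_seminorm p2 \<and> continuous_map T2 euclideanreal p2}"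

end

theory Submission
  imports Defs
begin

text \<open>
  A \<open>C\<^sup>*\<close>-seminorm \<open>q\<close> on a commutative algebra satisfies \<open>q (x\<^sup>2) = q(x)\<^sup>2\<close>, and at every \<open>z\<close> its
  value is attained by a \<open>*\<close>-character dominated by \<open>q\<close>: a Zorn-minimal seminorm below \<open>q\<close> with
  this square property and the same value at \<open>z\<close> is multiplicative, so Gelfand--Mazur applies to
  it. Hence the supremum defining \<open>p\<^sub>1 \<otimes>\<^sub>\<epsilon> p\<^sub>2\<close> may be restricted to pairs of \<open>*\<close>-characters, which
  makes \<open>p\<^sub>1 \<otimes>\<^sub>\<epsilon> p\<^sub>2\<close> a \<open>C\<^sup>*\<close>-seminorm. Conversely, a character of \<open>A\<^sub>1 \<otimes> A\<^sub>2\<close> is a product of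
  characters, so every \<open>C\<^sup>*\<close>-seminorm \<open>q\<close> on \<open>A\<^sub>1 \<otimes> A\<^sub>2\<close> is at most
  \<open>q(\<cdot> \<otimes> 1) \<otimes>\<^sub>\<epsilon> q(1 \<otimes> \<cdot>)\<close>; continuity of \<open>\<otimes>\<close> makes both factors continuous when \<open>q\<close> is.
\<close>

section \<open>Seminorms\<close>

lemma scaleC_zero_left: "0 *\<^sub>C (x::'a::complex_comm_algebra) = 0"
  by (metis add.right_neutral add_cancel_right_right scaleC_add_left)

lemma scaleC_minus_left: "(- c) *\<^sub>C (x::'a::complex_comm_algebra) = - (c *\<^sub>C x)"
  by (metis add.right_inverse add.inverse_unique scaleC_add_left scaleC_zero_left)

lemma scaleC_diff_left: "(c - d) *\<^sub>C (x::'a::complex_comm_algebra) = c *\<^sub>C x - d *\<^sub>C x"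
  by (metis diff_conv_add_uminus scaleC_add_left scaleC_minus_left)

context
  fixes p :: "'a::complex_comm_algebra \<Rightarrow> real"
  assumes p: "cseminorm p"
begin

lemma cseminorm_nonneg: "0 \<le> p x"
  and cseminorm_add: "p (x + y) \<le> p x + p y"
  and cseminorm_scaleC: "p (c *\<^sub>C x) = cmod c * p x"
  using p by (auto simp: cseminorm_def)

lemma cseminorm_zero: "p 0 = 0"
  using cseminorm_scaleC[of 0 0] by (simp add: scaleC_zero_left)

lemma cseminorm_minus: "p (- x) = p x"
  using cseminorm_scaleC[of "-1" x] by (simp add: scaleC_minus_left scaleC_one)

lemma cseminorm_diff: "p (x - y) \<le> p x + p y"
  using cseminorm_add[of x "- y"] by (simp add: cseminorm_minus)

lemma cseminorm_diff_commute: "p (x - y) = p (y - x)"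
  using cseminorm_minus[of "x - y"] by simp

lemma cseminorm_triangle: "p (x - z) \<le> p (x - y) + p (y - z)"
  using cseminorm_add[of "x - y" "y - z"] by simp

lemma cseminorm_abs_diff: "\<bar>p x - p y\<bar> \<le> p (x - y)"
  using cseminorm_add[of "x - y" y] cseminorm_add[of "y - x" x] cseminorm_diff_commute[of x y]
  by simp

end

text \<open>The star-free shadow of the C*-identity, and the class in which Zorn's lemma is applied.
  It survives localization at an arbitrary \<open>a\<close> because
  \<open>a ^ (2 * n) * (x * x)\<close> is the square of \<open>a ^ n * x\<close>; with
  \<open>x * star x\<close> the matching factor would be
  \<open>a ^ n * star (a ^ n)\<close>.\<close>

definition square_seminorm :: "('a::complex_comm_algebra \<Rightarrow> real) \<Rightarrow> bool" where
  "square_seminorm p \<longleftrightarrow> cseminorm p \<and> (\<forall>x. p (x * x) = (p x)\<^sup>2)"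

lemma square_seminorm_power:
  assumes "square_seminorm p"
  shows "p (x ^ 2 ^ k) = p x ^ 2 ^ k"
proof (induction k)
  case (Suc k)
  have "x ^ 2 ^ Suc k = x ^ 2 ^ k * x ^ 2 ^ k"
    by (simp add: mult_2 power_add)
  then have "p (x ^ 2 ^ Suc k) = (p (x ^ 2 ^ k))\<^sup>2"
    using assms by (simp add: square_seminorm_def)
  also have "\<dots> = p x ^ 2 ^ Suc k"
    by (simp add: Suc power_mult [symmetric] mult.commute)
  finally show ?case .
qed simp

text \<open>Powers of a number above 1 are unbounded, and \<open>n \<le> 2 ^ n\<close> makes the
  exponents \<open>2 ^ k\<close> enough to see it. This removes a constant that is uniform in the
  exponent.\<close>

lemma le_one_if_powers_bounded:
  fixes t :: real
  assumes "\<And>k. t ^ 2 ^ k \<le> C"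
  shows "t \<le> 1"
proof (rule ccontr)
  assume "\<not> t \<le> 1"
  then obtain n where n: "C < t ^ n" using real_arch_pow[of t C] by auto
  have "t ^ n \<le> t ^ 2 ^ n"
    using \<open>\<not> t \<le> 1\<close> by (intro power_increasing) (auto simp: less_imp_le)
  with n assms[of n] show False by simp
qed

text \<open>
  Polarization bounds \<^term>\<open>p (x * y)\<close> by \<open>2\<close> on the unit ball, and the square
  identity then improves the constant to \<open>1\<close>.
\<close>

lemma square_seminorm_mult:
  assumes p: "square_seminorm p"
  shows "p (x * y) \<le> p x * p y"
proof -
  have s: "cseminorm p" using p by (simp add: square_seminorm_def)
  have sq: "p (u * u) = (p u)\<^sup>2" for u using p by (simp add: square_seminorm_def)
  have unit: "p (u * v) \<le> 2" if "p u \<le> 1" "p v \<le> 1" for u v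
  proof -
    \<comment> \<open>Writing 4 as a sum of ones turns the scalar multiple into repeated addition,
      which the ring laws can compare with the polarization formula.\<close>
    have "4 *\<^sub>C (u * v) = (1 + 1 + 1 + 1) *\<^sub>C (u * v)" by simp
    also have "\<dots> = (u + v) * (u + v) - (u - v) * (u - v)"
      unfolding scaleC_add_left scaleC_one by (simp add: algebra_simps)
    finally have "4 * p (u * v) = p ((u + v) * (u + v) - (u - v) * (u - v))"
      using cseminorm_scaleC[OF s, of 4 "u * v"] by simp
    also have "\<dots> \<le> (p (u + v))\<^sup>2 + (p (u - v))\<^sup>2"
      using cseminorm_diff[OF s] by (simp flip: sq)
    also have "\<dots> \<le> 2\<^sup>2 + 2\<^sup>2"
      using that cseminorm_add[OF s, of u v] cseminorm_diff[OF s, of u v]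
      by (intro add_mono power_mono) (auto intro: cseminorm_nonneg[OF s])
    finally show ?thesis by simp
  qed
  have unit': "p (u * v) \<le> 1" if "p u \<le> 1" "p v \<le> 1" for u v
  proof (rule le_one_if_powers_bounded)
    fix k
    have "p (u * v) ^ 2 ^ k = p (u ^ 2 ^ k * v ^ 2 ^ k)"
      by (simp flip: square_seminorm_power[OF p] add: power_mult_distrib)
    also have "\<dots> \<le> 2"
      using that by (intro unit) (auto simp: square_seminorm_power[OF p]
          intro!: power_le_one cseminorm_nonneg[OF s])
    finally show "p (u * v) ^ 2 ^ k \<le> 2" .
  qed
  \<comment> \<open>Normalizing by \<open>p x + e\<close> instead of \<open>p x\<close> also covers
    elements of seminorm 0; afterwards \<open>e\<close> tends to 0.\<close>
  have eps: "p (x * y) \<le> (p x + e) * (p y + e)" if "e > 0" for e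
  proof -
    define a b where "a = p x + e" and "b = p y + e"
    have ab: "a > 0" "b > 0" "p x \<le> a" "p y \<le> b"
      using that cseminorm_nonneg[OF s, of x] cseminorm_nonneg[OF s, of y]
      by (auto simp: a_def b_def)
    have "p ((complex_of_real (1 / a) *\<^sub>C x) * (complex_of_real (1 / b) *\<^sub>C y)) \<le> 1"
      using ab by (intro unit') (auto simp: cseminorm_scaleC[OF s] norm_divide)
    then have "p (x * y) / (a * b) \<le> 1"
      using ab by (simp add: mult_scaleC_left mult_scaleC_right scaleC_scaleC
          cseminorm_scaleC[OF s] norm_divide norm_mult mult.commute)
    then have "p (x * y) \<le> a * b" using ab by (simp add: pos_divide_le_eq)
    then show ?thesis by (simp add: a_def b_def)
  qed
  have "((\<lambda>e. (p x + e) * (p y + e)) \<longlongrightarrow> (p x + 0) * (p y + 0)) (at_right 0)"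
    by (intro tendsto_intros)
  moreover have "eventually (\<lambda>e. p (x * y) \<le> (p x + e) * (p y + e)) (at_right 0)"
    using eps by (auto simp: eventually_at_right_less eventually_at_filter)
  ultimately show ?thesis
    using tendsto_lowerbound by fastforce
qed

section \<open>Multiplicative seminorms\<close>

context
  fixes r :: "'a::complex_comm_algebra \<Rightarrow> real"
  assumes r: "cseminorm r" and mult: "\<And>x y. r (x * y) = r x * r y" and one: "r 1 = 1"
begin

lemma mult_seminorm_power: "r (x ^ n) = r x ^ n"
  by (induction n) (simp_all add: mult one)

lemma mult_seminorm_scalar: "r (c *\<^sub>C 1) = cmod c"
  by (simp add: cseminorm_scaleC[OF r] one)

lemma scalar_square_diff:
  fixes u :: 'a
  shows "u * u - (c * c) *\<^sub>C 1 = (u - c *\<^sub>C 1) * (u + c *\<^sub>C 1)"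
  by (simp add: algebra_simps mult_scaleC_left mult_scaleC_right scaleC_scaleC)

text \<open>Every complex scalar is a square, so \<open>y ^ 2 ^ Suc k - c *\<^sub>C 1\<close> splits
  into two factors of the same shape at level \<open>k\<close>, with scalars \<open>s\<close> and
  \<open>- s\<close>. Hence the induction must range over all \<open>c\<close>.\<close>

lemma scalar_distance_power:
  assumes m: "0 \<le> m" "\<And>c. m \<le> r (y - c *\<^sub>C 1)"
  shows "m ^ 2 ^ k \<le> r (y ^ 2 ^ k - c *\<^sub>C 1)"
proof (induction k arbitrary: c)
  case (Suc k)
  define s where "s = csqrt c"
  have c: "c = s * s" by (simp add: s_def flip: power2_eq_square)
  have "y ^ 2 ^ Suc k - c *\<^sub>C 1 = (y ^ 2 ^ k - s *\<^sub>C 1) * (y ^ 2 ^ k - (- s) *\<^sub>C 1)"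
    by (simp add: c mult_2 power_add scalar_square_diff scaleC_minus_left)
  then have "r (y ^ 2 ^ Suc k - c *\<^sub>C 1) = r (y ^ 2 ^ k - s *\<^sub>C 1) * r (y ^ 2 ^ k - (- s) *\<^sub>C 1)"
    by (simp only: mult)
  also have "\<dots> \<ge> m ^ 2 ^ k * m ^ 2 ^ k"
    using Suc m by (intro mult_mono cseminorm_nonneg[OF r]) auto
  finally show ?case by (simp add: mult_2 power_add)
qed (use m in simp)

text \<open>
  Comparing \<open>y\<^bsup>N\<^esup> - e\<^bsup>N\<^esup> = (y - e) \<cdot> \<Prod>(y - \<zeta> e)\<close>, whose cofactors all have seminorm at least
  \<open>m\<close>, with the triangle inequality shows that the distance to the scalars stays minimal
  within the radius \<open>m\<close>; \<open>e = m / 2\<close> suffices.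
\<close>

lemma scalar_distance_shift:
  assumes m: "0 < m" "\<And>c. m \<le> r (y - c *\<^sub>C 1)" and y: "r y = m"
  shows "r (y - complex_of_real (m / 2) *\<^sub>C 1) = m"
proof (rule antisym)
  define e where "e = complex_of_real (m / 2)"
  have ne: "cmod e = m / 2" using m(1) by (simp add: e_def norm_divide)
  \<comment> \<open>Iterated factorization of a difference of squares. The cofactors of
    \<open>y - e\<close> contribute \<open>m\<close> to the power \<open>2 ^ k - 1\<close>;
    multiplying both sides by \<open>m\<close> avoids the subtraction in the exponent.\<close>
  have lower: "r (y - e *\<^sub>C 1) * m ^ 2 ^ k \<le> m * r (y ^ 2 ^ k - (e ^ 2 ^ k) *\<^sub>C 1)" for k
  proof (induction k)
    case (Suc k)
    have "r (y - e *\<^sub>C 1) * m ^ 2 ^ Suc k = (r (y - e *\<^sub>C 1) * m ^ 2 ^ k) * m ^ 2 ^ k"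
      by (simp add: mult_2 power_add)
    also have "\<dots> \<le> (m * r (y ^ 2 ^ k - (e ^ 2 ^ k) *\<^sub>C 1)) * r (y ^ 2 ^ k - (- (e ^ 2 ^ k)) *\<^sub>C 1)"
      using m by (intro mult_mono[OF Suc] scalar_distance_power)
        (auto intro!: mult_nonneg_nonneg cseminorm_nonneg[OF r])
    also have "\<dots> = m * r (y ^ 2 ^ Suc k - (e ^ 2 ^ Suc k) *\<^sub>C 1)"
      by (simp add: mult_2 power_add scalar_square_diff scaleC_minus_left mult)
    finally show ?case .
  qed simp
  have bound: "r (y - e *\<^sub>C 1) / m \<le> 1 + (1 / 2) ^ 2 ^ k" for k
  proof -
    have "r (y ^ 2 ^ k - (e ^ 2 ^ k) *\<^sub>C 1) \<le> m ^ 2 ^ k + (m / 2) ^ 2 ^ k"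
      using cseminorm_diff[OF r, of "y ^ 2 ^ k" "(e ^ 2 ^ k) *\<^sub>C 1"]
      by (simp only: mult_seminorm_power mult_seminorm_scalar y norm_power ne)
    then have "r (y - e *\<^sub>C 1) * m ^ 2 ^ k \<le> m * (m ^ 2 ^ k + (m / 2) ^ 2 ^ k)"
      using lower[of k] m(1) by (meson mult_left_mono less_imp_le order_trans)
    also have "\<dots> = m * (1 + (1 / 2) ^ 2 ^ k) * m ^ 2 ^ k"
      by (simp add: power_divide field_simps)
    finally have "r (y - e *\<^sub>C 1) \<le> m * (1 + (1 / 2) ^ 2 ^ k)" using m(1) by simp
    then show ?thesis using m(1) by (simp add: pos_divide_le_eq mult.commute)
  qed
  have "(\<lambda>k. 1 + (1 / 2 :: real) ^ 2 ^ k) \<longlonglongrightarrow> 1 + 0"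
  proof (intro tendsto_add tendsto_const)
    have "(\<lambda>n. (1 / 2 :: real) ^ n) \<longlonglongrightarrow> 0" by (rule LIMSEQ_realpow_zero) auto
    moreover have "strict_mono (\<lambda>k::nat. 2 ^ k :: nat)" by (simp add: strict_mono_def)
    ultimately show "(\<lambda>k. (1 / 2 :: real) ^ 2 ^ k) \<longlonglongrightarrow> 0"
      using LIMSEQ_subseq_LIMSEQ[unfolded o_def] by blast
  qed
  then have "r (y - e *\<^sub>C 1) / m \<le> 1 + 0"
    by (rule LIMSEQ_le_const) (use bound in blast)
  then show "r (y - complex_of_real (m / 2) *\<^sub>C 1) \<le> m"
    using m(1) by (simp add: e_def)
qed (rule m)

text \<open>By compactness the distance from \<open>x\<close> to the scalars is attained, say with
  value \<open>m\<close> at \<open>c0\<close>. If \<open>m > 0\<close>, then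
  \<open>scalar_distance_shift\<close> makes \<open>c0 + m / 2\<close> another minimizer, and
  repeating this produces minimizers arbitrarily far from \<open>c0\<close>; but two minimizers
  differ by at most \<open>2 * m\<close>.\<close>

lemma gelfand_mazur: "\<exists>c. r (x - c *\<^sub>C 1) = 0"
proof -
  define f where "f c = r (x - c *\<^sub>C 1)" for c
  have lip: "\<bar>f c - f d\<bar> \<le> cmod (c - d)" for c d
  proof -
    have "(x - c *\<^sub>C 1) - (x - d *\<^sub>C 1) = (d - c) *\<^sub>C 1" by (simp add: scaleC_diff_left)
    then show ?thesis
      using cseminorm_abs_diff[OF r, of "x - c *\<^sub>C 1" "x - d *\<^sub>C 1"]
      by (simp add: f_def mult_seminorm_scalar norm_minus_commute)
  qed
  \<comment> \<open>Outside this disc \<open>f c\<close> is at least \<open>cmod c - r x\<close>,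
    which exceeds \<open>r x = f 0\<close>, so the minimum on the disc is global.\<close>
  have "continuous_on (cball 0 (2 * r x)) f"
    unfolding continuous_on_iff dist_real_def dist_complex_def using lip
    by (meson le_less_trans)
  then obtain c0 where c0: "c0 \<in> cball 0 (2 * r x)" "\<And>c. c \<in> cball 0 (2 * r x) \<Longrightarrow> f c0 \<le> f c"
    using continuous_attains_inf[of "cball 0 (2 * r x)" f] cseminorm_nonneg[OF r, of x]
    by auto
  have min: "f c0 \<le> f c" for c
  proof (cases "c \<in> cball 0 (2 * r x)")
    case False
    have "f c0 \<le> f 0" using c0(2) cseminorm_nonneg[OF r, of x] by simp
    also have "f 0 = r x" by (simp add: f_def scaleC_zero_left)
    also have "\<dots> \<le> f c"
      using False cseminorm_abs_diff[OF r, of "c *\<^sub>C 1" x]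
        cseminorm_diff_commute[OF r, of "c *\<^sub>C 1" x]
      by (simp add: f_def mult_seminorm_scalar)
    finally show ?thesis .
  qed (use c0 in blast)
  define m where "m = f c0"
  have "m = 0"
  proof (rule ccontr)
    assume "m \<noteq> 0"
    then have m: "m > 0" using cseminorm_nonneg[OF r] by (simp add: m_def f_def less_le)
    have far: "f (c0 + complex_of_real (real n * (m / 2))) = m" for n
    proof (induction n)
      case (Suc n)
      define d where "d = c0 + complex_of_real (real n * (m / 2))"
      have "r ((x - d *\<^sub>C 1) - complex_of_real (m / 2) *\<^sub>C 1) = m"
      proof (rule scalar_distance_shift[OF m])
        show "m \<le> r ((x - d *\<^sub>C 1) - c *\<^sub>C 1)" for c
          using min[of "d + c"] by (simp add: f_def m_def scaleC_add_left diff_diff_eq)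
        show "r (x - d *\<^sub>C 1) = m" using Suc by (simp add: f_def d_def)
      qed
      moreover have "d + complex_of_real (m / 2) = c0 + complex_of_real (real (Suc n) * (m / 2))"
        by (simp add: d_def algebra_simps add_divide_distrib)
      ultimately show ?case
        by (metis f_def scaleC_add_left diff_diff_eq)
    qed (simp add: m_def)
    obtain n where n: "real n * (m / 2) > 2 * m" using reals_Archimedean3[of "m / 2"] m by auto
    have "cmod (complex_of_real (real n * (m / 2)))
        = r ((x - c0 *\<^sub>C 1) - (x - (c0 + complex_of_real (real n * (m / 2))) *\<^sub>C 1))"
      by (simp add: scaleC_add_left mult_seminorm_scalar del: of_real_mult of_real_divide)
    also have "\<dots> \<le> m + m"
      using far[of n] cseminorm_diff[OF r, of "x - c0 *\<^sub>C 1"]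
      by (metis f_def m_def)
    finally show False using n m by (simp add: norm_mult norm_divide)
  qed
  then show ?thesis by (auto simp: m_def f_def)
qed

text \<open>Modulo the kernel of \<open>r\<close>, each \<open>x\<close> is a scalar by
  \<open>gelfand_mazur\<close>. The scalar is unique because
  \<open>r (c *\<^sub>C 1) = cmod c\<close>, and each algebraic law for \<open>w\<close> follows by
  checking that the expected scalar works.\<close>

lemma mult_seminorm_character:
  obtains w where "clinear_functional w" "\<And>x y. w (x * y) = w x * w y" "\<And>x. cmod (w x) = r x"
proof -
  obtain w where w: "\<And>x. r (x - w x *\<^sub>C 1) = 0" using gelfand_mazur by metis
  have unique: "w x = c" if "r (x - c *\<^sub>C 1) = 0" for x c
  proof -
    have "cmod (w x - c) = r ((w x - c) *\<^sub>C 1)" by (simp add: mult_seminorm_scalar)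
    also have "\<dots> = r ((x - c *\<^sub>C 1) - (x - w x *\<^sub>C 1))" by (simp add: scaleC_diff_left)
    also have "\<dots> \<le> 0" using cseminorm_diff[OF r] that w by (metis add_0)
    finally show ?thesis by simp
  qed
  have zero: "r v = 0" if "r v \<le> 0" for v using that cseminorm_nonneg[OF r, of v] by simp
  have "w (x + y) = w x + w y" for x y
  proof (intro unique zero)
    have "x + y - (w x + w y) *\<^sub>C 1 = (x - w x *\<^sub>C 1) + (y - w y *\<^sub>C 1)"
      by (simp add: scaleC_add_left algebra_simps)
    then show "r (x + y - (w x + w y) *\<^sub>C 1) \<le> 0"
      using cseminorm_add[OF r, of "x - w x *\<^sub>C 1" "y - w y *\<^sub>C 1"] by (simp only: w)
  qed
  moreover have "w (x * y) = w x * w y" for x y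
  proof (intro unique zero)
    have "x * y - (w x * w y) *\<^sub>C 1 = x * (y - w y *\<^sub>C 1) + (w y *\<^sub>C 1) * (x - w x *\<^sub>C 1)"
      by (simp add: algebra_simps mult_scaleC_left mult_scaleC_right scaleC_scaleC)
    then show "r (x * y - (w x * w y) *\<^sub>C 1) \<le> 0"
      using cseminorm_add[OF r, of "x * (y - w y *\<^sub>C 1)" "(w y *\<^sub>C 1) * (x - w x *\<^sub>C 1)"] w
      by (simp add: mult)
  qed
  moreover have "w (c *\<^sub>C x) = c * w x" for c x
  proof (intro unique)
    have "c *\<^sub>C x - (c * w x) *\<^sub>C 1 = (c *\<^sub>C 1) * (x - w x *\<^sub>C 1)"
      by (simp add: algebra_simps mult_scaleC_left mult_scaleC_right scaleC_scaleC)
    then show "r (c *\<^sub>C x - (c * w x) *\<^sub>C 1) = 0" using w by (simp add: mult)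
  qed
  moreover have "cmod (w x) = r x" for x
    using cseminorm_abs_diff[OF r, of x "w x *\<^sub>C 1"] w[of x] by (simp add: mult_seminorm_scalar)
  ultimately show ?thesis using that[of w] by (simp add: clinear_functional_iff)
qed

end

section \<open>Characters attaining a square seminorm\<close>

lemma square_seminormI:
  assumes "\<And>x. 0 \<le> r x" "\<And>x y. r (x + y) \<le> r x + r y"
    and "\<And>c x. r (c *\<^sub>C x) = cmod c * r x" "\<And>x. r (x * x) = (r x)\<^sup>2"
  shows "square_seminorm r"
  using assms by (simp add: square_seminorm_def cseminorm_def)

text \<open>Supplies the lower bounds of chains for Zorn's lemma. Total ordering enters through the
  triangle inequality, where two members of the chain are replaced by the smaller one.\<close>

lemma square_seminorm_chain_Inf:
  assumes sq: "\<And>r. r \<in> C \<Longrightarrow> square_seminorm r" and ne: "C \<noteq> {}"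
    and chain: "\<And>r s. r \<in> C \<Longrightarrow> s \<in> C \<Longrightarrow> r \<le> s \<or> s \<le> r"
  shows "square_seminorm (\<lambda>x. INF r\<in>C. r x)"
proof (rule square_seminormI)
  define i where "i x = (INF r\<in>C. r x)" for x
  have sm: "cseminorm r" if "r \<in> C" for r using sq[OF that] by (simp add: square_seminorm_def)
  have bdd: "bdd_below ((\<lambda>r. r x) ` C)" for x
    using cseminorm_nonneg[OF sm] by (auto intro!: bdd_belowI)
  have lower: "i x \<le> r x" if "r \<in> C" for r x
    unfolding i_def using that bdd by (rule cINF_lower[rotated])
  have greatest: "b \<le> i x" if "\<And>r. r \<in> C \<Longrightarrow> b \<le> r x" for b x
    unfolding i_def using that ne by (intro cINF_greatest)
  show nonneg: "0 \<le> (INF r\<in>C. r x)" for x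
    using greatest cseminorm_nonneg[OF sm] by (simp add: i_def)
  show "(INF r\<in>C. r (x + y)) \<le> (INF r\<in>C. r x) + (INF r\<in>C. r y)" for x y
  proof -
    \<comment> \<open>Two independent members on the right allow the infimum to be taken over
      \<open>r\<close> and then over \<open>s\<close>.\<close>
    have both: "i (x + y) \<le> r x + s y" if rs: "r \<in> C" "s \<in> C" for r s
    proof -
      obtain t where t: "t \<in> C" "t \<le> r" "t \<le> s" using chain[OF rs] rs by auto
      have "i (x + y) \<le> t x + t y"
        using lower[OF t(1)] cseminorm_add[OF sm[OF t(1)]] by (rule order_trans)
      also have "\<dots> \<le> r x + s y" using t by (intro add_mono) (auto simp: le_fun_def)
      finally show ?thesis .
    qed
    have "i (x + y) - i x \<le> i y"
    proof (rule greatest)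
      fix s assume s: "s \<in> C"
      have "i (x + y) - s y \<le> i x" by (rule greatest) (use both s in \<open>simp add: algebra_simps\<close>)
      then show "i (x + y) - i x \<le> s y" by simp
    qed
    then show ?thesis by (simp add: i_def)
  qed
  show "(INF r\<in>C. r (c *\<^sub>C x)) = cmod c * (INF r\<in>C. r x)" for c x
  proof (cases "c = 0")
    case True
    then show ?thesis using ne by (simp add: scaleC_zero_left cseminorm_zero[OF sm] cong: INF_cong)
  next
    case False
    have "i (c *\<^sub>C x) \<le> cmod c * i x"
    proof -
      have "i (c *\<^sub>C x) / cmod c \<le> i x"
        by (rule greatest)
          (use False lower[of _ "c *\<^sub>C x"] in \<open>simp add: cseminorm_scaleC[OF sm] field_simps\<close>)
      then show ?thesis using False by (simp add: field_simps)
    qed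
    moreover have "cmod c * i x \<le> i (c *\<^sub>C x)"
      by (rule greatest) (simp add: cseminorm_scaleC[OF sm] lower mult_left_mono)
    ultimately show ?thesis by (simp add: i_def)
  qed
  show "(INF r\<in>C. r (x * x)) = (INF r\<in>C. r x)\<^sup>2" for x
  proof -
    have eq: "r (x * x) = (r x)\<^sup>2" if "r \<in> C" for r
      using sq[OF that] by (simp add: square_seminorm_def)
    have "i (x * x) \<le> (i x)\<^sup>2"
    proof -
      have "sqrt (i (x * x)) \<le> i x"
      proof (rule greatest)
        fix r assume r: "r \<in> C"
        then have "i (x * x) \<le> (r x)\<^sup>2" using lower[OF r, of "x * x"] eq by simp
        then show "sqrt (i (x * x)) \<le> r x"
          using cseminorm_nonneg[OF sm[OF r]] by (simp add: real_le_lsqrt)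
      qed
      then show ?thesis
        using nonneg[of "x * x"] by (metis i_def sqrt_le_D)
    qed
    moreover have "(i x)\<^sup>2 \<le> i (x * x)"
      by (rule greatest) (use nonneg lower in \<open>auto simp: eq i_def intro!: power_mono\<close>)
    ultimately show ?thesis by (simp add: i_def)
  qed
qed

text \<open>The quotients \<open>r (a ^ n * x) / r a ^ n\<close> decrease by submultiplicativity, so
  they converge. Replacing \<open>x\<close> by \<open>a * x\<close> shifts the index and pulls out a
  factor \<open>r a\<close>, so the limit is multiplicative in \<open>a\<close>. The limit formula
  is exported in order to compute \<open>s\<close> at a chosen point.\<close>

lemma square_seminorm_localize:
  assumes r: "square_seminorm r" and a: "r a \<noteq> 0"
  obtains s where "square_seminorm s" "\<And>x. s x \<le> r x" "\<And>x. s (a * x) = r a * s x"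
    "\<And>x. (\<lambda>n. r (a ^ n * x) / r a ^ n) \<longlonglongrightarrow> s x"
proof -
  have sm: "cseminorm r" using r by (simp add: square_seminorm_def)
  have pos: "r a > 0" using a cseminorm_nonneg[OF sm, of a] by simp
  define f where "f n x = r (a ^ n * x) / r a ^ n" for n x
  have nonneg: "0 \<le> f n x" for n x using pos cseminorm_nonneg[OF sm] by (simp add: f_def)
  have "f (Suc n) x \<le> f n x" for n x
    using square_seminorm_mult[OF r, of a "a ^ n * x"] pos
    by (simp add: f_def field_simps)
  then have "decseq (\<lambda>n. f n x)" for x by (intro decseq_SucI)
  then have "\<exists>L. (\<lambda>n. f n x) \<longlonglongrightarrow> L \<and> (\<forall>n. L \<le> f n x)" for x
    using nonneg by (metis decseq_convergent)
  then obtain s where s: "\<And>x. (\<lambda>n. f n x) \<longlonglongrightarrow> s x" and le: "\<And>n x. s x \<le> f n x"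
    by metis
  show ?thesis
  proof
    show "(\<lambda>n. r (a ^ n * x) / r a ^ n) \<longlonglongrightarrow> s x" for x using s by (simp add: f_def)
    show "s x \<le> r x" for x using le[of x 0] by (simp add: f_def)
    show "s (a * x) = r a * s x" for x
    proof (rule LIMSEQ_unique[OF s])
      have "f n (a * x) = r a * f (Suc n) x" for n
        using pos by (simp add: f_def field_simps mult.left_commute)
      then show "(\<lambda>n. f n (a * x)) \<longlonglongrightarrow> r a * s x"
        using tendsto_mult_left[OF LIMSEQ_Suc[OF s]] by simp
    qed
    show "square_seminorm s"
    proof (rule square_seminormI)
      show "0 \<le> s x" for x by (rule LIMSEQ_le_const[OF s]) (use nonneg in blast)
      have "f n (x + y) \<le> f n x + f n y" for n x y
        using cseminorm_add[OF sm, of "a ^ n * x" "a ^ n * y"] pos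
        by (simp add: f_def distrib_left divide_right_mono flip: add_divide_distrib)
      then show "s (x + y) \<le> s x + s y" for x y
        using LIMSEQ_le[OF s tendsto_add[OF s s]] by blast
      show "s (c *\<^sub>C x) = cmod c * s x" for c x
      proof (rule LIMSEQ_unique[OF s])
        have "f n (c *\<^sub>C x) = cmod c * f n x" for n
          by (simp add: f_def mult_scaleC_right cseminorm_scaleC[OF sm])
        then show "(\<lambda>n. f n (c *\<^sub>C x)) \<longlonglongrightarrow> cmod c * s x"
          using tendsto_mult_left[OF s] by simp
      qed
      \<comment> \<open>The square identity holds before the limit, between index
        \<open>2 * n\<close> at \<open>x * x\<close> and index \<open>n\<close> at \<open>x\<close>,
        so the even subsequence is used.\<close>
      show "s (x * x) = (s x)\<^sup>2" for x
      proof (rule LIMSEQ_unique)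
        show "(\<lambda>n. f (2 * n) (x * x)) \<longlonglongrightarrow> s (x * x)"
          using LIMSEQ_subseq_LIMSEQ[OF s, of "\<lambda>n. 2 * n"] by (simp add: strict_mono_def o_def)
        have "f (2 * n) (x * x) = (f n x)\<^sup>2" for n
        proof -
          have "a ^ (2 * n) * (x * x) = (a ^ n * x) * (a ^ n * x)"
            by (simp add: mult_2 power_add mult.assoc mult.left_commute)
          then have "r (a ^ (2 * n) * (x * x)) = (r (a ^ n * x))\<^sup>2"
            using r by (simp only: square_seminorm_def)
          then show ?thesis by (simp add: f_def power_divide power_mult mult.commute)
        qed
        then show "(\<lambda>n. f (2 * n) (x * x)) \<longlonglongrightarrow> (s x)\<^sup>2"
          using tendsto_power[OF s] by simp
      qed
    qed
  qed
qed

text \<open>The lower bound comes from padding the exponent to a power of 2, where equality is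
  known, and cancelling the padding. Exponent 0 is left out because \<open>r 1 = 1\<close> fails for
  the zero seminorm.\<close>

lemma square_seminorm_power_Suc:
  assumes r: "square_seminorm r"
  shows "r (x ^ Suc n) = r x ^ Suc n"
proof (rule antisym)
  have sm: "cseminorm r" using r by (simp add: square_seminorm_def)
  have upper: "r (x ^ Suc n) \<le> r x ^ Suc n" for n
  proof (induction n)
    case (Suc n)
    have "r (x ^ Suc (Suc n)) \<le> r x * r (x ^ Suc n)"
      using square_seminorm_mult[OF r, of x "x ^ Suc n"] by simp
    also have "\<dots> \<le> r x * r x ^ Suc n"
      using Suc cseminorm_nonneg[OF sm] by (intro mult_left_mono)
    finally show ?case by simp
  qed simp
  then show "r (x ^ Suc n) \<le> r x ^ Suc n" .
  show "r x ^ Suc n \<le> r (x ^ Suc n)"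
  proof (cases "r x = 0")
    case True
    then show ?thesis using cseminorm_nonneg[OF sm] by simp
  next
    case False
    then have pos: "r x > 0" using cseminorm_nonneg[OF sm, of x] by simp
    \<comment> \<open>Strictness leaves a positive padding exponent \<open>Suc d\<close>, to which
      \<open>upper\<close> applies.\<close>
    have "Suc n < 2 ^ Suc n" by (rule less_exp)
    then obtain d where d: "2 ^ Suc n = Suc n + Suc d" by (metis less_iff_Suc_add add_Suc_right)
    have "r x ^ Suc n * r x ^ Suc d = r (x ^ Suc n * x ^ Suc d)"
      using square_seminorm_power[OF r, of x "Suc n"] unfolding d power_add by simp
    also have "\<dots> \<le> r (x ^ Suc n) * r x ^ Suc d"
      using order_trans[OF square_seminorm_mult[OF r] mult_left_mono[OF upper cseminorm_nonneg[OF sm]]] .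
    finally show ?thesis using pos by (simp del: power_Suc)
  qed
qed

text \<open>
  A minimal square seminorm below \<open>q\<close> with the given value at \<open>z\<close> agrees with its localization
  first at \<open>z\<close> and then at every other element, hence is multiplicative.
\<close>

lemma square_seminorm_character:
  assumes q: "square_seminorm q" and z: "q z \<noteq> 0"
  obtains w where "clinear_functional w" "\<And>x y. w (x * y) = w x * w y"
    "\<And>x. cmod (w x) \<le> q x" "cmod (w z) = q z"
proof -
  define S where "S = {r. square_seminorm r \<and> r \<le> q \<and> r z = q z}"
  \<comment> \<open>The order is reversed, so the maximal element given by Zorn's lemma is a minimal
    seminorm.\<close>
  define P :: "('a \<Rightarrow> real) \<Rightarrow> ('a \<Rightarrow> real) \<Rightarrow> bool" where "P r s \<longleftrightarrow> s \<le> r" for r s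
  have "\<exists>m\<in>S. \<forall>a\<in>S. P m a \<longrightarrow> a = m"
  proof (rule predicate_Zorn)
    show "partial_order_on S (relation_of P S)"
      by (rule partial_order_on_relation_ofI) (auto simp: P_def)
    fix C assume C: "C \<in> Chains (relation_of P S)"
    show "\<exists>u\<in>S. \<forall>a\<in>C. P a u"
    proof (cases "C = {}")
      \<comment> \<open>An infimum over the empty chain would be meaningless; \<open>q\<close>
        itself is the bound.\<close>
      case True
      then show ?thesis using q by (auto simp: S_def)
    next
      case False
      have sub: "C \<subseteq> S" using C by (auto simp: Chains_def relation_of_def)
      have lower: "(INF r\<in>C. r x) \<le> r x" if "r \<in> C" for r x
        using that sub by (intro cINF_lower bdd_belowI[of _ 0])
          (auto simp: S_def square_seminorm_def cseminorm_def)
      have "square_seminorm (\<lambda>x. INF r\<in>C. r x)"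
        using C False sub
        by (intro square_seminorm_chain_Inf) (auto simp: Chains_def relation_of_def P_def S_def)
      moreover have "(INF r\<in>C. r z) = q z"
      proof -
        have "r z = q z" if "r \<in> C" for r
          using subsetD[OF sub that] by (simp add: S_def)
        then have "(\<lambda>r. r z) ` C = (\<lambda>_. q z) ` C" by (rule image_cong[OF refl])
        then show ?thesis using False by simp
      qed
      moreover have "(\<lambda>x. INF r\<in>C. r x) \<le> q"
      proof -
        obtain r where "r \<in> C" using False by blast
        then have "(INF r\<in>C. r x) \<le> q x" for x
          using lower[of r x] subsetD[OF sub, of r] by (simp add: S_def le_fun_def) (meson order_trans)
        then show ?thesis by (simp add: le_fun_def)
      qed
      ultimately have "(\<lambda>x. INF r\<in>C. r x) \<in> S" by (simp add: S_def)
      then show ?thesis using lower by (intro bexI[of _ "\<lambda>x. INF r\<in>C. r x"]) (auto simp: P_def le_fun_def)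
    qed
  qed
  then obtain r where r: "square_seminorm r" "r \<le> q" "r z = q z"
    and min: "\<And>s. s \<in> S \<Longrightarrow> s \<le> r \<Longrightarrow> s = r"
    by (auto simp: S_def P_def)
  have sm: "cseminorm r" using r by (simp add: square_seminorm_def)
  \<comment> \<open>The condition \<open>az\<close> makes the localization at \<open>a\<close> keep
    the value at \<open>z\<close>. The localization then lies in \<open>S\<close> below
    \<open>r\<close>, so minimality identifies the two.\<close>
  have mult: "r (a * x) = r a * r x" if a: "r a \<noteq> 0" and az: "\<And>n. r (a ^ n * z) = r a ^ n * r z" for a x
  proof -
    obtain s where s: "square_seminorm s" "\<And>x. s x \<le> r x" "\<And>x. s (a * x) = r a * s x"
      "\<And>x. (\<lambda>n. r (a ^ n * x) / r a ^ n) \<longlonglongrightarrow> s x"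
      using square_seminorm_localize[OF r(1) a] by metis
    have "s z = r z"
      by (rule LIMSEQ_unique[OF s(4)]) (simp add: az a)
    then have "s \<in> S" using s(1,2) r(2,3) by (simp add: S_def le_fun_def) (meson order_trans)
    then have "s = r" using s by (intro min) (auto simp: le_fun_def)
    then show ?thesis using s(3) by simp
  qed
  have z_mult: "r (z * x) = r z * r x" for x
  proof (rule mult)
    show "r z \<noteq> 0" using z r by simp
    show "r (z ^ n * z) = r z ^ n * r z" for n
      using square_seminorm_power_Suc[OF r(1), of z n] by (simp add: mult.commute)
  qed
  have one: "r 1 = 1" using z_mult[of 1] z r by simp
  have r_mult: "r (a * x) = r a * r x" for a x
  proof (cases "r a = 0")
    case True
    then show ?thesis
      using square_seminorm_mult[OF r(1), of a x] cseminorm_nonneg[OF sm, of "a * x"] by simp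
  next
    case False
    then show ?thesis
    proof (rule mult)
      \<comment> \<open>Multiplicativity at \<open>z\<close> reduces this to powers of
        \<open>a\<close>; the exponent 0 is covered by \<open>one\<close>.\<close>
      show "r (a ^ n * z) = r a ^ n * r z" for n
        using square_seminorm_power_Suc[OF r(1), of a "n - 1"] z_mult[of "a ^ n"] one
        by (cases n) (simp_all add: mult.commute)
    qed
  qed
  obtain w where "clinear_functional w" "\<And>x y. w (x * y) = w x * w y" "\<And>x. cmod (w x) = r x"
    using mult_seminorm_character[OF sm r_mult one] by metis
  then show ?thesis using that r by (simp add: le_fun_def)
qed

section \<open>C*-seminorms and *-characters\<close>

lemma star_one: "star (1::'a::involutive_algebra) = 1"
  by (metis mult.left_neutral star_mult star_star)

lemma cstar_seminorm_cseminorm: "cstar_seminorm p \<Longrightarrow> cseminorm p"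
  by (simp add: cstar_seminorm_def)

text \<open>By commutativity, \<open>x * x\<close> times its adjoint equals
  \<open>x * star x\<close> times its adjoint. Applying the C*-identity to both sides gives equality
  of the squares of \<open>p (x * x)\<close> and \<open>(p x)\<^sup>2\<close>.\<close>

lemma cstar_seminorm_square:
  assumes "cstar_seminorm p"
  shows "square_seminorm p"
proof -
  have eq: "p (x * star x) = (p x)\<^sup>2" for x using assms by (simp add: cstar_seminorm_def)
  have "(p (x * x))\<^sup>2 = ((p x)\<^sup>2)\<^sup>2" for x
  proof -
    have "(p (x * x))\<^sup>2 = p ((x * star x) * star (x * star x))"
      by (simp add: star_mult star_star ac_simps flip: eq)
    then show ?thesis by (simp only: eq)
  qed
  then have "p (x * x) = (p x)\<^sup>2" for x
    using cseminorm_nonneg[OF cstar_seminorm_cseminorm[OF assms]]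
    by (meson power2_eq_iff_nonneg zero_le_power2)
  then show ?thesis using assms by (simp add: square_seminorm_def cstar_seminorm_def)
qed

text \<open>Since \<open>w 1 = 1\<close> is not demanded, the zero functional qualifies; it attains
  the seminorm at points where that vanishes.\<close>

definition star_character :: "('a::involutive_algebra \<Rightarrow> complex) \<Rightarrow> bool" where
  "star_character w \<longleftrightarrow> clinear_functional w \<and> (\<forall>x y. w (x * y) = w x * w y) \<and>
    (\<forall>x. w (star x) = cnj (w x))"

text \<open>
  The classical estimate for \<open>w (h + i t)\<close> with \<open>h\<close> self-adjoint and \<open>t\<close> real
  excludes an imaginary part of \<open>w h\<close>.
\<close>

lemma bounded_character_star:
  assumes q: "cstar_seminorm q" and w: "clinear_functional w" "\<And>x y. w (x * y) = w x * w y"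
    and le: "\<And>x. cmod (w x) \<le> q x" and nz: "w z \<noteq> 0"
  shows "star_character w"
proof -
  have add: "w (x + y) = w x + w y" and scale: "w (c *\<^sub>C x) = c * w x" for x y c
    using w(1) by (auto simp: clinear_functional_iff)
  have sm: "cseminorm q" using q by (rule cstar_seminorm_cseminorm)
  have eq: "q (x * star x) = (q x)\<^sup>2" for x using q by (simp add: cstar_seminorm_def)
  have one: "w 1 = 1" using w(2)[of z 1] nz by simp
  have q1: "q 1 \<le> 1" using eq[of 1] by (auto simp: star_one power2_eq_square)
  have real: "Im (w h) = 0" if h: "star h = h" for h
  proof (rule ccontr)
    define b K where "b = Im (w h)" and "K = q (h * h)"
    assume "Im (w h) \<noteq> 0"
    then have b: "b \<noteq> 0" by (simp add: b_def)
    have "b\<^sup>2 + 2 * b * t \<le> K" for t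
    proof -
      define y where "y = h + (\<i> * complex_of_real t) *\<^sub>C 1"
      have "y * star y = h * h + complex_of_real (t\<^sup>2) *\<^sub>C 1"
        unfolding of_real_power power2_eq_square
        by (simp add: y_def h star_add star_scaleC star_one algebra_simps mult_scaleC_left
            mult_scaleC_right scaleC_scaleC scaleC_minus_left)
      then have "(q y)\<^sup>2 = q (h * h + complex_of_real (t\<^sup>2) *\<^sub>C 1)"
        by (metis eq)
      also have "\<dots> \<le> K + q (complex_of_real (t\<^sup>2) *\<^sub>C 1)"
        unfolding K_def by (rule cseminorm_add[OF sm])
      also have "\<dots> = K + t\<^sup>2 * q 1"
        unfolding cseminorm_scaleC[OF sm] by (simp add: norm_power)
      also have "\<dots> \<le> K + t\<^sup>2" using q1 mult_left_mono[OF q1, of "t\<^sup>2"] by simp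
      finally have "(q y)\<^sup>2 \<le> K + t\<^sup>2" .
      moreover have "(b + t)\<^sup>2 \<le> (q y)\<^sup>2"
      proof -
        have "\<bar>b + t\<bar> \<le> cmod (w y)"
          using abs_Im_le_cmod[of "w y"] by (simp add: y_def add scale one b_def)
        then show ?thesis using le[of y] by (simp add: abs_le_square_iff[symmetric])
      qed
      ultimately show ?thesis by (simp add: power2_sum)
    qed
    \<comment> \<open>The bound is affine in \<open>t\<close> with nonzero slope; this choice of
      \<open>t\<close> turns it into \<open>b\<^sup>2 + 2 * K \<le> K\<close>.\<close>
    from this[of "K / b"] have "b\<^sup>2 + K \<le> 0" using b by simp
    moreover have "b\<^sup>2 > 0" "K \<ge> 0" using b cseminorm_nonneg[OF sm] by (simp_all add: K_def)
    ultimately show False by simp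
  qed
  have "w (star x) = cnj (w x)" for x
  proof (rule complex_eqI)
    \<comment> \<open>Reality is tested on two self-adjoint elements: \<open>x + star x\<close>
      settles the imaginary parts, and \<open>x - star x\<close> multiplied by the imaginary unit
      settles the real parts.\<close>
    have "Im (w (x + star x)) = 0"
      by (rule real) (simp add: star_add star_star add.commute)
    then show "Im (w (star x)) = Im (cnj (w x))" by (simp add: add)
    have "Im (w (\<i> *\<^sub>C x + (- \<i>) *\<^sub>C star x)) = 0"
      by (rule real) (simp add: star_add star_scaleC star_star add.commute)
    then show "Re (w (star x)) = Re (cnj (w x))" by (simp add: add scale)
  qed
  then show ?thesis using w by (simp add: star_character_def)
qed

lemma cstar_seminorm_attained:
  assumes "cstar_seminorm q"
  obtains w where "star_character w" "\<And>x. cmod (w x) \<le> q x" "cmod (w z) = q z"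
proof (cases "q z = 0")
  case True
  have "star_character (\<lambda>_. 0)" by (simp add: star_character_def clinear_functional_iff)
  then show ?thesis
    using that True cseminorm_nonneg[OF cstar_seminorm_cseminorm[OF assms]] by fastforce
next
  case False
  obtain w where w: "clinear_functional w" "\<And>x y. w (x * y) = w x * w y"
    "\<And>x. cmod (w x) \<le> q x" "cmod (w z) = q z"
    using square_seminorm_character[OF cstar_seminorm_square[OF assms] False] by metis
  moreover have "w z \<noteq> 0" using w False by auto
  ultimately show ?thesis using that bounded_character_star[OF assms] by metis
qed

section \<open>Topologies generated by seminorms\<close>

lemma topspace_seminorm_topology [simp]: "topspace (seminorm_topology P) = UNIV"
  by (auto simp: seminorm_topology_def)

text \<open>Taking \<open>q = p\<close> gives open balls for members of \<open>P\<close>; taking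
  \<open>q\<close> from another family compares two seminorm topologies.\<close>

lemma openin_seminorm_ball:
  assumes "p \<in> P" and q: "cseminorm q" and le: "\<And>x. q x \<le> p x" and p0: "p 0 = 0"
  shows "openin (seminorm_topology P) {y. q (y - x) < e}"
proof (subst openin_subopen, safe)
  fix y assume y: "q (y - x) < e"
  have "openin (seminorm_topology P) {z. p (z - y) < e - q (y - x)}"
    unfolding seminorm_topology_def using y assms(1)
    by (intro topology_generated_by_Basis) force
  moreover have "y \<in> {z. p (z - y) < e - q (y - x)}" using y by (simp add: p0)
  moreover have "{z. p (z - y) < e - q (y - x)} \<subseteq> {z. q (z - x) < e}"
  proof safe
    fix z assume "p (z - y) < e - q (y - x)"
    then show "q (z - x) < e" using le[of "z - y"] cseminorm_triangle[OF q, of z x y] by simp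
  qed
  ultimately show "\<exists>U. openin (seminorm_topology P) U \<and> y \<in> U \<and> U \<subseteq> {y. q (y - x) < e}"
    by blast
qed

lemma continuous_map_seminorm:
  assumes "p \<in> P" and p: "cseminorm p"
  shows "continuous_map (seminorm_topology P) euclideanreal p"
  unfolding continuous_map_def
proof (intro conjI allI impI)
  fix U :: "real set" assume "openin euclideanreal U"
  then have U: "open U" by simp
  have "openin (seminorm_topology P) {x. p x \<in> U}"
  proof (subst openin_subopen, safe)
    fix x assume "p x \<in> U"
    then obtain e where e: "e > 0" "ball (p x) e \<subseteq> U" using U open_contains_ball by blast
    have "openin (seminorm_topology P) {y. p (y - x) < e}"
      using assms by (intro openin_seminorm_ball[of p]) (auto intro: cseminorm_zero)
    moreover have "x \<in> {y. p (y - x) < e}" using e by (simp add: cseminorm_zero[OF p])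
    moreover have "{y. p (y - x) < e} \<subseteq> {y. p y \<in> U}"
    proof safe
      fix y assume "p (y - x) < e"
      then have "p y \<in> ball (p x) e"
        using cseminorm_abs_diff[OF p, of y x] by (simp add: dist_real_def abs_minus_commute)
      then show "p y \<in> U" using e by blast
    qed
    ultimately show "\<exists>V. openin (seminorm_topology P) V \<and> x \<in> V \<and> V \<subseteq> {x. p x \<in> U}" by blast
  qed
  then show "openin (seminorm_topology P) {x \<in> topspace (seminorm_topology P). p x \<in> U}" by simp
qed simp

lemma continuous_map_into_seminorm_topology:
  fixes P :: "('b::complex_comm_algebra \<Rightarrow> real) set"
  assumes "\<And>p x e. p \<in> P \<Longrightarrow> e > 0 \<Longrightarrow> openin X {u \<in> topspace X. p (f u - x) < e}"
  shows "continuous_map X (seminorm_topology P) f"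
  unfolding seminorm_topology_def
proof (rule continuous_on_generated_topo)
  fix U assume "U \<in> insert UNIV {{y. p (y - x) < e} | p x e. p \<in> P \<and> e > 0}"
  then show "openin X (f -` U \<inter> topspace X)"
  proof safe
    fix p :: "'b \<Rightarrow> real" and x and e :: real assume "p \<in> P" "e > 0"
    moreover have "f -` {y. p (y - x) < e} \<inter> topspace X = {u \<in> topspace X. p (f u - x) < e}"
      by auto
    ultimately show "openin X (f -` {y. p (y - x) < e} \<inter> topspace X)" using assms by simp
  qed simp
qed simp

text \<open>A continuous seminorm need not belong to the generating family, so continuity of
  \<open>p (x - a)\<close> in \<open>x\<close> is obtained by composing \<open>p\<close> with this
  map.\<close>

lemma continuous_map_translation:
  "continuous_map (seminorm_topology P) (seminorm_topology P) (\<lambda>x. x - a)"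
proof (rule continuous_map_into_seminorm_topology)
  fix p and x :: 'a and e :: real assume p: "p \<in> P" and e: "e > 0"
  have "{u \<in> topspace (seminorm_topology P). p (u - a - x) < e} = {u. p (u - (a + x)) < e}"
    by (simp add: diff_diff_eq)
  moreover have "openin (seminorm_topology P) {u. p (u - (a + x)) < e}"
    unfolding seminorm_topology_def using p e by (intro topology_generated_by_Basis) blast
  ultimately show "openin (seminorm_topology P) {u \<in> topspace (seminorm_topology P). p (u - a - x) < e}"
    by simp
qed

lemma finer_seminorm_topology:
  assumes "\<And>q. q \<in> Q \<Longrightarrow> cseminorm q"
    and "\<And>q. q \<in> Q \<Longrightarrow> \<exists>p\<in>P. p 0 = 0 \<and> (\<forall>x. q x \<le> p x)"
  shows "finer_topology (seminorm_topology P) (seminorm_topology Q)"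
proof -
  have "continuous_map (seminorm_topology P) (seminorm_topology Q) (\<lambda>x. x)"
  proof (rule continuous_map_into_seminorm_topology)
    fix q and x :: 'a and e :: real assume "q \<in> Q"
    then show "openin (seminorm_topology P) {u \<in> topspace (seminorm_topology P). q (u - x) < e}"
      using assms openin_seminorm_ball[of _ P q x e] by auto
  qed
  then show ?thesis by (simp add: continuous_map_def finer_topology_def)
qed

section \<open>The injective seminorms\<close>

definition dominated :: "('a::complex_comm_algebra \<Rightarrow> complex) \<Rightarrow> ('a \<Rightarrow> real) \<Rightarrow> bool" where
  "dominated w p \<longleftrightarrow> clinear_functional w \<and> (\<forall>a. cmod (w a) \<le> p a)"

lemma dominated_zero: "cseminorm p \<Longrightarrow> dominated (\<lambda>_. 0) p"
  by (simp add: dominated_def clinear_functional_iff cseminorm_nonneg)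

abbreviation product_form ::
    "('a::complex_comm_algebra \<Rightarrow> complex) \<Rightarrow> ('b::complex_comm_algebra \<Rightarrow> complex) \<Rightarrow>
      ('a, 'b) tensor \<Rightarrow> complex" where
  "product_form w1 w2 \<equiv> tensor_form (\<lambda>a b. w1 a * w2 b)"

text \<open>The element \<open>a\<close> is the image of \<open>z\<close> under the slice map
  sending \<open>a \<otimes>\<^sub>t b\<close> to \<open>w2 b *\<^sub>C a\<close>. It does not
  depend on \<open>w1\<close>, so \<open>w1\<close> can later be exchanged while \<open>a\<close>
  stays fixed.\<close>

lemma product_form_slice_left:
  assumes "clinear_functional w2"
  obtains a where "\<And>w1. clinear_functional w1 \<Longrightarrow> product_form w1 w2 z = w1 a"
proof -
  have "\<exists>a. \<forall>w1. clinear_functional w1 \<longrightarrow> product_form w1 w2 z = w1 a"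
  proof (induction z rule: tensor_induct)
    case (tensor a b)
    have "product_form w1 w2 (a \<otimes>\<^sub>t b) = w1 (w2 b *\<^sub>C a)" if "clinear_functional w1" for w1
      using that by (simp add: tensor_form_tensor[OF bilinear_form_mult[OF that assms]]
          clinear_functional_iff)
    then show ?case by blast
  next
    case (add x y)
    then obtain a a' where "\<forall>w1. clinear_functional w1 \<longrightarrow> product_form w1 w2 x = w1 a"
      "\<forall>w1. clinear_functional w1 \<longrightarrow> product_form w1 w2 y = w1 a'" by blast
    then have "\<forall>w1. clinear_functional w1 \<longrightarrow> product_form w1 w2 (x + y) = w1 (a + a')"
      by (simp add: tensor_form_add clinear_functional_iff)
    then show ?case by blast
  qed
  then show ?thesis using that by blast
qed

lemma product_form_slice_right:
  assumes "clinear_functional w1"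
  obtains b where "\<And>w2. clinear_functional w2 \<Longrightarrow> product_form w1 w2 z = w2 b"
proof -
  have "\<exists>b. \<forall>w2. clinear_functional w2 \<longrightarrow> product_form w1 w2 z = w2 b"
  proof (induction z rule: tensor_induct)
    case (tensor a b)
    have "product_form w1 w2 (a \<otimes>\<^sub>t b) = w2 (w1 a *\<^sub>C b)" if "clinear_functional w2" for w2
      using that by (simp add: tensor_form_tensor[OF bilinear_form_mult[OF assms that]]
          clinear_functional_iff)
    then show ?case by blast
  next
    case (add x y)
    then obtain b b' where "\<forall>w2. clinear_functional w2 \<longrightarrow> product_form w1 w2 x = w2 b"
      "\<forall>w2. clinear_functional w2 \<longrightarrow> product_form w1 w2 y = w2 b'" by blast
    then have "\<forall>w2. clinear_functional w2 \<longrightarrow> product_form w1 w2 (x + y) = w2 (b + b')"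
      by (simp add: tensor_form_add clinear_functional_iff)
    then show ?case by blast
  qed
  then show ?thesis using that by blast
qed

text \<open>A real supremum is informative only for sets bounded above; this provides the bound, by
  induction over sums of elementary tensors.\<close>

lemma product_form_bounded:
  assumes "cseminorm p1" "cseminorm p2"
  shows "\<exists>C. \<forall>w1 w2. dominated w1 p1 \<longrightarrow> dominated w2 p2 \<longrightarrow> cmod (product_form w1 w2 z) \<le> C"
proof (induction z rule: tensor_induct)
  case (tensor a b)
  have "cmod (product_form w1 w2 (a \<otimes>\<^sub>t b)) \<le> p1 a * p2 b" if "dominated w1 p1" "dominated w2 p2" for w1 w2
    using that by (auto simp: dominated_def tensor_form_tensor bilinear_form_mult norm_mult
        intro!: mult_mono cseminorm_nonneg[OF assms(1)])
  then show ?case by blast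
next
  case (add x y)
  then obtain C D where "\<forall>w1 w2. dominated w1 p1 \<longrightarrow> dominated w2 p2 \<longrightarrow> cmod (product_form w1 w2 x) \<le> C"
    "\<forall>w1 w2. dominated w1 p1 \<longrightarrow> dominated w2 p2 \<longrightarrow> cmod (product_form w1 w2 y) \<le> D" by blast
  then have "\<forall>w1 w2. dominated w1 p1 \<longrightarrow> dominated w2 p2 \<longrightarrow> cmod (product_form w1 w2 (x + y)) \<le> C + D"
    unfolding tensor_form_add by (meson norm_triangle_mono)
  then show ?case by blast
qed

lemma injective_seminorm_alt:
  "(p1 \<otimes>\<^sub>\<epsilon> p2) z =
    Sup {cmod (product_form w1 w2 z) | w1 w2. dominated w1 p1 \<and> dominated w2 p2}"
  unfolding injective_seminorm_def dominated_def by (simp only: conj_assoc)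

context
  fixes p1 :: "'a::complex_comm_algebra \<Rightarrow> real" and p2 :: "'b::complex_comm_algebra \<Rightarrow> real"
  assumes p1: "cseminorm p1" and p2: "cseminorm p2"
begin

lemma injective_seminorm_upper:
  assumes "dominated w1 p1" "dominated w2 p2"
  shows "cmod (product_form w1 w2 z) \<le> (p1 \<otimes>\<^sub>\<epsilon> p2) z"
  unfolding injective_seminorm_alt
proof (rule cSup_upper)
  show "bdd_above {cmod (product_form w1 w2 z) | w1 w2. dominated w1 p1 \<and> dominated w2 p2}"
    using product_form_bounded[OF p1 p2, of z] by (auto simp: bdd_above_def)
qed (use assms in blast)

lemma injective_seminorm_least:
  assumes "\<And>w1 w2. dominated w1 p1 \<Longrightarrow> dominated w2 p2 \<Longrightarrow> cmod (product_form w1 w2 z) \<le> C"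
  shows "(p1 \<otimes>\<^sub>\<epsilon> p2) z \<le> C"
  unfolding injective_seminorm_alt
  by (rule cSup_least) (use assms dominated_zero[OF p1] dominated_zero[OF p2] in blast)+

lemma injective_seminorm_nonneg: "0 \<le> (p1 \<otimes>\<^sub>\<epsilon> p2) z"
  using injective_seminorm_upper[OF dominated_zero[OF p1] dominated_zero[OF p2]]
  by (meson norm_ge_zero order_trans)

lemma cseminorm_injective: "cseminorm (p1 \<otimes>\<^sub>\<epsilon> p2)"
  unfolding cseminorm_def
proof (intro conjI allI)
  show "(p1 \<otimes>\<^sub>\<epsilon> p2) (x + y) \<le> (p1 \<otimes>\<^sub>\<epsilon> p2) x + (p1 \<otimes>\<^sub>\<epsilon> p2) y" for x y
    by (rule injective_seminorm_least)
      (simp add: tensor_form_add norm_triangle_mono injective_seminorm_upper)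
  have le: "(p1 \<otimes>\<^sub>\<epsilon> p2) (c *\<^sub>C x) \<le> cmod c * (p1 \<otimes>\<^sub>\<epsilon> p2) x" for c x
    by (rule injective_seminorm_least)
      (simp add: tensor_form_scaleC norm_mult mult_left_mono injective_seminorm_upper)
  show "(p1 \<otimes>\<^sub>\<epsilon> p2) (c *\<^sub>C x) = cmod c * (p1 \<otimes>\<^sub>\<epsilon> p2) x" for c x
  proof (cases "c = 0")
    case True
    then show ?thesis using le[of c x] injective_seminorm_nonneg[of "c *\<^sub>C x"] by simp
  next
    case False
    then have "(p1 \<otimes>\<^sub>\<epsilon> p2) x \<le> (p1 \<otimes>\<^sub>\<epsilon> p2) (c *\<^sub>C x) / cmod c"
      using le[of "inverse c" "c *\<^sub>C x"]
      by (simp add: scaleC_scaleC scaleC_one norm_inverse divide_inverse mult.commute)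
    then show ?thesis using False le[of c x] by (simp add: field_simps)
  qed
qed (rule injective_seminorm_nonneg)

text \<open>The cross-seminorm estimate behind the continuity of the canonical bilinear map.\<close>

lemma injective_seminorm_tensor_le: "(p1 \<otimes>\<^sub>\<epsilon> p2) (a \<otimes>\<^sub>t b) \<le> p1 a * p2 b"
  by (rule injective_seminorm_least)
    (auto simp: dominated_def tensor_form_tensor bilinear_form_mult norm_mult
      intro!: mult_mono cseminorm_nonneg[OF p1])

end

section \<open>Products of characters and the C*-identity for injective seminorms\<close>

lemma star_character_product_form:
  assumes "star_character w1" "star_character w2"
  shows "product_form w1 w2 (x * y) = product_form w1 w2 x * product_form w1 w2 y"
    and "product_form w1 w2 (star x) = cnj (product_form w1 w2 x)"
proof -
  have pure: "product_form w1 w2 (a \<otimes>\<^sub>t b) = w1 a * w2 b" for a b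
    using assms by (simp add: star_character_def tensor_form_tensor bilinear_form_mult)
  have left: "product_form w1 w2 ((a \<otimes>\<^sub>t b) * y) = product_form w1 w2 (a \<otimes>\<^sub>t b) * product_form w1 w2 y"
    for a b
  proof (induction y rule: tensor_induct)
    case (tensor a' b')
    show ?case using assms by (simp add: tensor_mult pure star_character_def)
  next
    case (add x y)
    then show ?case by (simp add: distrib_left tensor_form_add)
  qed
  show "product_form w1 w2 (x * y) = product_form w1 w2 x * product_form w1 w2 y"
    by (induction x rule: tensor_induct) (simp_all add: left distrib_right tensor_form_add)
  show "product_form w1 w2 (star x) = cnj (product_form w1 w2 x)"
    by (induction x rule: tensor_induct)
      (use assms in \<open>simp_all add: tensor_star pure star_add tensor_form_add star_character_def\<close>)
qed

text \<open>Replacing one factor at a time: a slice of \<open>z\<close> is an element of \<open>A\<^sub>1\<close> or \<open>A\<^sub>2\<close>.\<close>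

lemma product_form_le_characters:
  assumes "cstar_seminorm p1" "cstar_seminorm p2" and w: "dominated w1 p1" "dominated w2 p2"
  obtains v1 v2 where "star_character v1" "dominated v1 p1" "star_character v2" "dominated v2 p2"
    "cmod (product_form w1 w2 z) \<le> cmod (product_form v1 v2 z)"
proof -
  obtain a where a: "\<And>w1. clinear_functional w1 \<Longrightarrow> product_form w1 w2 z = w1 a"
    using product_form_slice_left w(2) by (metis dominated_def)
  obtain v1 where v1: "star_character v1" "\<And>x. cmod (v1 x) \<le> p1 x" "cmod (v1 a) = p1 a"
    using cstar_seminorm_attained[OF assms(1)] by metis
  have lin1: "clinear_functional v1" using v1(1) by (simp add: star_character_def)
  \<comment> \<open>The second slice is taken along the new \<open>v1\<close>, so that replacing
    \<open>w2\<close> builds on the first replacement.\<close>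
  obtain b where b: "\<And>w2. clinear_functional w2 \<Longrightarrow> product_form v1 w2 z = w2 b"
    using product_form_slice_right[OF lin1] by metis
  obtain v2 where v2: "star_character v2" "\<And>x. cmod (v2 x) \<le> p2 x" "cmod (v2 b) = p2 b"
    using cstar_seminorm_attained[OF assms(2)] by metis
  have lin2: "clinear_functional v2" using v2(1) by (simp add: star_character_def)
  have "cmod (product_form w1 w2 z) \<le> p1 a" using w(1) by (simp add: a dominated_def)
  also have "p1 a = cmod (product_form v1 w2 z)" using v1(3) by (simp add: a[OF lin1])
  also have "\<dots> \<le> p2 b" using w(2) by (simp add: b dominated_def)
  also have "p2 b = cmod (product_form v1 v2 z)" using v2(3) by (simp add: b[OF lin2])
  finally show ?thesis using that v1 v2 lin1 lin2 by (simp add: dominated_def)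
qed

text \<open>A product of *-characters takes at \<open>x * star x\<close> a value of modulus equal to
  the squared modulus at \<open>x\<close>. Both inequalities between the suprema follow after
  passing to characters, the second in square-root form.\<close>

lemma cstar_seminorm_injective:
  fixes p1 :: "'a::involutive_algebra \<Rightarrow> real" and p2 :: "'b::involutive_algebra \<Rightarrow> real"
  assumes p: "cstar_seminorm p1" "cstar_seminorm p2"
  shows "cstar_seminorm (p1 \<otimes>\<^sub>\<epsilon> p2)"
  unfolding cstar_seminorm_def
proof (intro conjI allI)
  note sm = cstar_seminorm_cseminorm[OF p(1)] cstar_seminorm_cseminorm[OF p(2)]
  note upper = injective_seminorm_upper[OF sm] and least = injective_seminorm_least[OF sm]
    and nonneg = injective_seminorm_nonneg[OF sm]
  show "cseminorm (p1 \<otimes>\<^sub>\<epsilon> p2)" using sm by (rule cseminorm_injective)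
  fix x :: "('a, 'b) tensor"
  have square: "cmod (product_form v1 v2 (x * star x)) = (cmod (product_form v1 v2 x))\<^sup>2"
    if "star_character v1" "star_character v2" for v1 v2
    by (simp add: star_character_product_form[OF that] norm_mult power2_eq_square)
  show "(p1 \<otimes>\<^sub>\<epsilon> p2) (x * star x) = ((p1 \<otimes>\<^sub>\<epsilon> p2) x)\<^sup>2"
  proof (rule antisym)
    show "(p1 \<otimes>\<^sub>\<epsilon> p2) (x * star x) \<le> ((p1 \<otimes>\<^sub>\<epsilon> p2) x)\<^sup>2"
    proof (rule least)
      fix w1 w2 assume w: "dominated w1 p1" "dominated w2 p2"
      obtain v1 v2 where v: "star_character v1" "dominated v1 p1" "star_character v2" "dominated v2 p2"
        "cmod (product_form w1 w2 (x * star x)) \<le> cmod (product_form v1 v2 (x * star x))"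
        by (rule product_form_le_characters[OF p w])
      note v(5)
      also have "cmod (product_form v1 v2 (x * star x)) \<le> ((p1 \<otimes>\<^sub>\<epsilon> p2) x)\<^sup>2"
        using v upper by (simp add: square power_mono)
      finally show "cmod (product_form w1 w2 (x * star x)) \<le> ((p1 \<otimes>\<^sub>\<epsilon> p2) x)\<^sup>2" .
    qed
    have "(p1 \<otimes>\<^sub>\<epsilon> p2) x \<le> sqrt ((p1 \<otimes>\<^sub>\<epsilon> p2) (x * star x))"
    proof (rule least)
      fix w1 w2 assume w: "dominated w1 p1" "dominated w2 p2"
      obtain v1 v2 where v: "star_character v1" "dominated v1 p1" "star_character v2" "dominated v2 p2"
        "cmod (product_form w1 w2 x) \<le> cmod (product_form v1 v2 x)"
        by (rule product_form_le_characters[OF p w])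
      note v(5)
      also have "cmod (product_form v1 v2 x) \<le> sqrt ((p1 \<otimes>\<^sub>\<epsilon> p2) (x * star x))"
        using upper[OF v(2,4), of "x * star x"] v by (simp add: square real_le_rsqrt)
      finally show "cmod (product_form w1 w2 x) \<le> sqrt ((p1 \<otimes>\<^sub>\<epsilon> p2) (x * star x))" .
    qed
    then show "((p1 \<otimes>\<^sub>\<epsilon> p2) x)\<^sup>2 \<le> (p1 \<otimes>\<^sub>\<epsilon> p2) (x * star x)"
      using nonneg by (metis power_mono real_sqrt_pow2)
  qed
qed

text \<open>The maps \<open>a \<mapsto> a \<otimes>\<^sub>t 1\<close> and
  \<open>b \<mapsto> 1 \<otimes>\<^sub>t b\<close> are *-homomorphisms, and C*-seminorms pull back
  along these.\<close>

lemma
  fixes q :: "('a::involutive_algebra, 'b::involutive_algebra) tensor \<Rightarrow> real"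
  assumes q: "cstar_seminorm q"
  shows cstar_seminorm_left_factor: "cstar_seminorm (\<lambda>a. q (a \<otimes>\<^sub>t 1))"
    and cstar_seminorm_right_factor: "cstar_seminorm (\<lambda>b. q (1 \<otimes>\<^sub>t b))"
proof -
  have sm: "cseminorm q" using q by (rule cstar_seminorm_cseminorm)
  have eq: "q (x * star x) = (q x)\<^sup>2" for x using q by (simp add: cstar_seminorm_def)
  show "cstar_seminorm (\<lambda>a. q (a \<otimes>\<^sub>t 1))"
    using eq[of "_ \<otimes>\<^sub>t 1"] cseminorm_nonneg[OF sm] cseminorm_add[OF sm]
    by (simp add: cstar_seminorm_def cseminorm_def tensor_add_left tensor_scaleC_left
        cseminorm_scaleC[OF sm] tensor_star tensor_mult star_one)
  show "cstar_seminorm (\<lambda>b. q (1 \<otimes>\<^sub>t b))"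
    using eq[of "1 \<otimes>\<^sub>t _"] cseminorm_nonneg[OF sm] cseminorm_add[OF sm]
    by (simp add: cstar_seminorm_def cseminorm_def tensor_add_right tensor_scaleC_right
        cseminorm_scaleC[OF sm] tensor_star tensor_mult star_one)
qed

text \<open>A character attaining \<open>q\<close> at \<open>z\<close> factors because \<open>a
  \<otimes>\<^sub>t b = (a \<otimes>\<^sub>t 1) * (1 \<otimes>\<^sub>t b)\<close>, and its two
  factors compete in the supremum on the right.\<close>

lemma cstar_seminorm_le_injective:
  fixes q :: "('a::involutive_algebra, 'b::involutive_algebra) tensor \<Rightarrow> real"
  assumes q: "cstar_seminorm q"
  shows "q z \<le> ((\<lambda>a. q (a \<otimes>\<^sub>t 1)) \<otimes>\<^sub>\<epsilon> (\<lambda>b. q (1 \<otimes>\<^sub>t b))) z"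
proof -
  obtain w where w: "star_character w" "\<And>x. cmod (w x) \<le> q x" "cmod (w z) = q z"
    using cstar_seminorm_attained[OF q] by metis
  define w1 w2 where "w1 a = w (a \<otimes>\<^sub>t 1)" and "w2 b = w (1 \<otimes>\<^sub>t b)" for a b
  have add: "w (x + y) = w x + w y" for x y
    using w(1) by (simp add: star_character_def clinear_functional_iff)
  have lin: "clinear_functional w1" "clinear_functional w2"
    using w(1) by (auto simp: w1_def w2_def star_character_def clinear_functional_iff
        tensor_add_left tensor_add_right tensor_scaleC_left tensor_scaleC_right)
  have "w x = product_form w1 w2 x" for x
  proof (induction x rule: tensor_induct)
    case (tensor a b)
    have "a \<otimes>\<^sub>t b = (a \<otimes>\<^sub>t 1) * (1 \<otimes>\<^sub>t b)" by (simp add: tensor_mult)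
    then have "w (a \<otimes>\<^sub>t b) = w1 a * w2 b"
      using w(1) by (simp only: star_character_def w1_def w2_def)
    then show ?case by (simp add: tensor_form_tensor bilinear_form_mult lin)
  qed (simp add: add tensor_form_add)
  then have "q z = cmod (product_form w1 w2 z)" using w(3) by simp
  also have "\<dots> \<le> ((\<lambda>a. q (a \<otimes>\<^sub>t 1)) \<otimes>\<^sub>\<epsilon> (\<lambda>b. q (1 \<otimes>\<^sub>t b))) z"
    using lin w(2) cstar_seminorm_left_factor[OF q] cstar_seminorm_right_factor[OF q]
    by (intro injective_seminorm_upper cstar_seminorm_cseminorm)
      (simp_all add: dominated_def, simp_all add: w1_def w2_def)
  finally show ?thesis .
qed

section \<open>The injective topology\<close>

lemma lc_star_injective_topology: "lc_star_topology (injective_topology T1 T2)"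
  unfolding lc_star_topology_def injective_topology_def
  by (rule exI, rule conjI[OF _ refl]) (auto intro: cstar_seminorm_injective)

lemma lc_star_topology_translation:
  assumes "lc_star_topology T"
  shows "continuous_map T T (\<lambda>x. x - a)" and "topspace T = UNIV"
  using assms by (auto simp: lc_star_topology_def continuous_map_translation)

lemma continuous_map_tensor_injective:
  fixes T1 :: "'a::involutive_algebra topology" and T2 :: "'b::involutive_algebra topology"
  assumes T1: "lc_star_topology T1" and T2: "lc_star_topology T2"
  shows "continuous_map (prod_topology T1 T2) (injective_topology T1 T2) (\<lambda>(a, b). a \<otimes>\<^sub>t b)"
  unfolding injective_topology_def
proof (rule continuous_map_into_seminorm_topology)
  fix p and x :: "('a, 'b) tensor" and e :: real
  assume "p \<in> {p1 \<otimes>\<^sub>\<epsilon> p2 | p1 p2. cstar_seminorm p1 \<and> continuous_map T1 euclideanreal p1 \<and>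
      cstar_seminorm p2 \<and> continuous_map T2 euclideanreal p2}"
  then obtain p1 p2 where p_eq: "p = p1 \<otimes>\<^sub>\<epsilon> p2"
    and p: "cstar_seminorm p1" "cstar_seminorm p2"
    and cont: "continuous_map T1 euclideanreal p1" "continuous_map T2 euclideanreal p2"
    by blast
  let ?X = "prod_topology T1 T2" and ?p = "p1 \<otimes>\<^sub>\<epsilon> p2"
  note sm = cstar_seminorm_cseminorm[OF p(1)] cstar_seminorm_cseminorm[OF p(2)]
  note smp = cseminorm_injective[OF sm]
  have top: "topspace ?X = UNIV"
    using lc_star_topology_translation(2)[OF T1] lc_star_topology_translation(2)[OF T2] by simp
  have "openin ?X {(a, b). ?p (a \<otimes>\<^sub>t b - x) < e}"
  proof (subst openin_subopen, rule ballI)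
    fix u0 assume "u0 \<in> {(a, b). ?p (a \<otimes>\<^sub>t b - x) < e}"
    then obtain a0 b0 where u0: "u0 = (a0, b0)" and less: "?p (a0 \<otimes>\<^sub>t b0 - x) < e"
      by auto
    \<comment> \<open>By \<open>injective_seminorm_tensor_le\<close>, \<open>g\<close> bounds the
      seminorm of \<open>a \<otimes>\<^sub>t b - a0 \<otimes>\<^sub>t b0\<close>, split as
      \<open>(a - a0) \<otimes>\<^sub>t b + a0 \<otimes>\<^sub>t (b - b0)\<close>. It is continuous
      and vanishes at \<open>(a0, b0)\<close>.\<close>
    define g where "g u = p1 (fst u - a0) * p2 (snd u) + p1 a0 * p2 (snd u - b0)" for u
    have "continuous_map ?X euclideanreal (p1 \<circ> ((\<lambda>a. a - a0) \<circ> fst))"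
      by (intro continuous_map_compose[OF _ cont(1)]
          continuous_map_compose[OF _ lc_star_topology_translation(1)[OF T1]] continuous_map_fst)
    moreover have "continuous_map ?X euclideanreal (p2 \<circ> ((\<lambda>b. b - b0) \<circ> snd))"
      by (intro continuous_map_compose[OF _ cont(2)]
          continuous_map_compose[OF _ lc_star_topology_translation(1)[OF T2]] continuous_map_snd)
    moreover have "continuous_map ?X euclideanreal (p2 \<circ> snd)"
      by (intro continuous_map_compose[OF _ cont(2)] continuous_map_snd)
    ultimately have "continuous_map ?X euclideanreal g"
      unfolding g_def o_def by (intro continuous_intros) auto
    then have "openin ?X {u \<in> topspace ?X. g u \<in> {..< e - ?p (a0 \<otimes>\<^sub>t b0 - x)}}"
      by (rule openin_continuous_map_preimage) simp
    moreover have "(a0, b0) \<in> {u \<in> topspace ?X. g u \<in> {..< e - ?p (a0 \<otimes>\<^sub>t b0 - x)}}"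
      using less unfolding top by (simp add: g_def cseminorm_zero sm)
    moreover have "{u \<in> topspace ?X. g u \<in> {..< e - ?p (a0 \<otimes>\<^sub>t b0 - x)}}
        \<subseteq> {(a, b). ?p (a \<otimes>\<^sub>t b - x) < e}"
    proof
      fix u assume "u \<in> {u \<in> topspace ?X. g u \<in> {..< e - ?p (a0 \<otimes>\<^sub>t b0 - x)}}"
      then obtain a b where u: "u = (a, b)" and g: "g (a, b) < e - ?p (a0 \<otimes>\<^sub>t b0 - x)"
        by (cases u) auto
      have "a \<otimes>\<^sub>t b = (a - a0) \<otimes>\<^sub>t b + a0 \<otimes>\<^sub>t b" "a0 \<otimes>\<^sub>t b = a0 \<otimes>\<^sub>t (b - b0) + a0 \<otimes>\<^sub>t b0"
        by (simp_all flip: tensor_add_left tensor_add_right)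
      then have "a \<otimes>\<^sub>t b - a0 \<otimes>\<^sub>t b0 = (a - a0) \<otimes>\<^sub>t b + a0 \<otimes>\<^sub>t (b - b0)" by simp
      then have "?p (a \<otimes>\<^sub>t b - a0 \<otimes>\<^sub>t b0) \<le> ?p ((a - a0) \<otimes>\<^sub>t b) + ?p (a0 \<otimes>\<^sub>t (b - b0))"
        using cseminorm_add[OF smp] by simp
      also have "\<dots> \<le> g (a, b)"
        using injective_seminorm_tensor_le[OF sm] by (simp add: g_def add_mono)
      finally show "u \<in> {(a, b). ?p (a \<otimes>\<^sub>t b - x) < e}"
        using g cseminorm_triangle[OF smp, of "a \<otimes>\<^sub>t b" x "a0 \<otimes>\<^sub>t b0"] by (simp add: u)
    qed
    ultimately show "\<exists>U. openin ?X U \<and> u0 \<in> U \<and> U \<subseteq> {(a, b). ?p (a \<otimes>\<^sub>t b - x) < e}"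
      unfolding u0 by (intro exI conjI)
  qed
  moreover have "{u \<in> topspace ?X. ?p ((case u of (a, b) \<Rightarrow> a \<otimes>\<^sub>t b) - x) < e} = {(a, b). ?p (a \<otimes>\<^sub>t b - x) < e}"
    unfolding top by auto
  ultimately show "openin ?X {u \<in> topspace ?X. p ((case u of (a, b) \<Rightarrow> a \<otimes>\<^sub>t b) - x) < e}"
    by (simp add: p_eq)
qed

text \<open>Each \<open>q\<close> defining \<open>T\<close> is dominated by the injective seminorm
  of its two restrictions. These are continuous, being \<open>q\<close> composed with the canonical
  map and the embeddings \<open>a \<mapsto> (a, 1)\<close> and \<open>b \<mapsto> (1, b)\<close>, so
  that injective seminorm is one of the generators.\<close>

lemma injective_topology_finest:
  fixes T1 :: "'a::involutive_algebra topology" and T2 :: "'b::involutive_algebra topology"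
  assumes T1: "lc_star_topology T1" and T2: "lc_star_topology T2" and "lc_star_topology T"
    and cont: "continuous_map (prod_topology T1 T2) T (\<lambda>(a, b). a \<otimes>\<^sub>t b)"
  shows "finer_topology (injective_topology T1 T2) T"
proof -
  obtain Q where Q: "\<forall>q\<in>Q. cstar_seminorm q" and T: "T = seminorm_topology Q"
    using assms(3) by (auto simp: lc_star_topology_def)
  have top: "topspace T1 = UNIV" "topspace T2 = UNIV"
    using lc_star_topology_translation(2) T1 T2 by blast+
  show ?thesis unfolding T injective_topology_def
  proof (rule finer_seminorm_topology)
    fix q assume q: "q \<in> Q"
    then have cq: "cstar_seminorm q" using Q by blast
    then show sm: "cseminorm q" by (rule cstar_seminorm_cseminorm)
    let ?p1 = "\<lambda>a. q (a \<otimes>\<^sub>t 1)" and ?p2 = "\<lambda>b. q (1 \<otimes>\<^sub>t b)"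
    have qc: "continuous_map T euclideanreal q"
      unfolding T using q sm by (rule continuous_map_seminorm)
    have qt: "continuous_map (prod_topology T1 T2) euclideanreal (q \<circ> (\<lambda>(a, b). a \<otimes>\<^sub>t b))"
      using cont qc by (rule continuous_map_compose)
    have "continuous_map T1 (prod_topology T1 T2) (\<lambda>a. (a, 1))"
      by (auto simp: continuous_map_pairwise o_def top)
    from continuous_map_compose[OF this qt] have c1: "continuous_map T1 euclideanreal ?p1"
      by (simp add: o_def)
    have "continuous_map T2 (prod_topology T1 T2) (\<lambda>b. (1, b))"
      by (auto simp: continuous_map_pairwise o_def top)
    from continuous_map_compose[OF this qt] have c2: "continuous_map T2 euclideanreal ?p2"
      by (simp add: o_def)
    let ?E = "{p1 \<otimes>\<^sub>\<epsilon> p2 | p1 p2. cstar_seminorm p1 \<and> continuous_map T1 euclideanreal p1 \<and>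
        cstar_seminorm p2 \<and> continuous_map T2 euclideanreal p2}"
    have "?p1 \<otimes>\<^sub>\<epsilon> ?p2 \<in> ?E"
      using c1 c2 cstar_seminorm_left_factor[OF cq] cstar_seminorm_right_factor[OF cq] by blast
    moreover have "(?p1 \<otimes>\<^sub>\<epsilon> ?p2) 0 = 0"
      using cstar_seminorm_left_factor[OF cq] cstar_seminorm_right_factor[OF cq]
      by (intro cseminorm_zero cseminorm_injective cstar_seminorm_cseminorm)
    ultimately show "\<exists>p\<in>?E. p 0 = 0 \<and> (\<forall>x. q x \<le> p x)"
      using cstar_seminorm_le_injective[OF cq] by (intro bexI[of _ "?p1 \<otimes>\<^sub>\<epsilon> ?p2"]) simp_all
  qed
qed

theorem corollary2p7:
  fixes T1 :: "'a::involutive_algebra topology" and T2 :: "'b::involutive_algebra topology"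
  assumes "lc_star_topology T1" and "Hausdorff_space T1"
    and "lc_star_topology T2" and "Hausdorff_space T2"
  shows "{\<tau>. lc_star_topology \<tau> \<and> finer_topology \<tau> (injective_topology T1 T2) \<and>
      continuous_map (prod_topology T1 T2) \<tau> (\<lambda>(a, b). a \<otimes>\<^sub>t b)} = {injective_topology T1 T2}"
proof (intro equalityI subsetI)
  fix \<tau> assume "\<tau> \<in> {\<tau>. lc_star_topology \<tau> \<and> finer_topology \<tau> (injective_topology T1 T2) \<and>
      continuous_map (prod_topology T1 T2) \<tau> (\<lambda>(a, b). a \<otimes>\<^sub>t b)}"
  \<comment> \<open>One comparison is assumed of \<tau>, the other is the maximality of the
    injective topology; together they force equality.\<close>
  then have "finer_topology \<tau> (injective_topology T1 T2)" "finer_topology (injective_topology T1 T2) \<tau>"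
    using injective_topology_finest[OF assms(1,3)] by auto
  then have "\<tau> = injective_topology T1 T2"
    by (auto simp: finer_topology_def topology_eq)
  then show "\<tau> \<in> {injective_topology T1 T2}" by simp
next
  fix \<tau> assume "\<tau> \<in> {injective_topology T1 T2}"
  then show "\<tau> \<in> {\<tau>. lc_star_topology \<tau> \<and> finer_topology \<tau> (injective_topology T1 T2) \<and>
      continuous_map (prod_topology T1 T2) \<tau> (\<lambda>(a, b). a \<otimes>\<^sub>t b)}"
    using lc_star_injective_topology continuous_map_tensor_injective[OF assms(1,3)]
    by (simp add: finer_topology_def)
qed

end
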